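(* Let $X$ be a Banach space and $f_k:X\to\mathbb{R}\cup\{+\infty\}$ $(k\in\mathbb{N}\cup\{0\})$ proper convex functions such that $C:=\operatorname{dom}f_0\cap\{x: f_k(x)\le0\ \forall k\in\mathbb{N}\}\neq\emptyset$. Let $\bar x\in X$ be a solution of problem (P): minimize $f_0(x)$ subject to $f_k(x)\le0$ $(k\in\mathbb{N})$. Suppose the Slater condition holds (there exists $x\in\operatorname{dom}f_0$ with $\sup_{k\in\mathbb{N}}f_k(x)<0$), and there exist $m\in\mathbb{N}\cup\{0\}$ and a solution $\lambda=(\lambda_1,\lambda_2,\ldots)\in\ell^\infty_+$ of problem (D$_m$) such that (i) the functions $f_0$, $\lambda_kf_k$ $(k=1,\ldots,m)$, $\lambda_kf_k^+$ $(k=m+1,m+2,\ldots)$ are lower semicontinuous on a neighbourhood of $\bar x$; (ii) the collection $\{f_0,\ \lambda_kf_k\ (k=1,\ldots,m),\ \lambda_kf_k^+\ (k=m+1,m+2,\ldots)\}$ is uniformly lower semicontinuous on a neighbourhood of $\bar x$. Then $\lambda_kf_k(\bar x)=0$ for $k=1,\ldots,m$, and for any $\varepsilon>0$ and $M>m$ there exist $n\in\mathbb{N}$ with $n>M$ and points $x_k\in B_\varepsilon(\bar x)$ $(k=0,\ldots,n)$ such that $$f_0(x_0)+\sum_{k=1}^m\lambda_kf_k(x_k)+\sum_{k=m+1}^n\lambda_kf_k^+(x_k)\le f_0(\bar x),$$ $$0\in\partial f_0(x_0)+\sum_{k=1}^m\lambda_k\partial f_k(x_k)+\sum_{k=m+1}^n\lambda_k\partial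 f_k^+(x_k)+\varepsilon\mathbb{B}^*,$$ with the convention $\lambda_k\partial f_k(x_k)=\lambda_k\partial f_k^+(x_k)=N_{\operatorname{dom}f_k}(x_k)$ when $\lambda_k=0$ $(k\in\mathbb{N})$.
   Context: Conventions: $0\cdot(+\infty)=+\infty$, $(+\infty)-(+\infty)=+\infty$. $f_k^+:=\max\{f_k,0\}$. $\ell^\infty_+$ is the set of nonnegative sequences in $\ell^\infty$. (D$_m$) is the problem $\sup_{\lambda\in\ell^\infty_+}\inf_{x\in X}\big(f_0(x)+\sum_{k=1}^m\lambda_kf_k(x)+\sum_{k=m+1}^\infty\lambda_kf_k^+(x)\big)$ (first sum zero if $m=0$); a solution attains the supremum. $B_\varepsilon(\bar x)$ is the open ball, $\mathbb{B}^*$ the open unit ball of $X^*$, $\partial$ the Fenchel subdifferential $\partial f(x)=\{x^*: f(y)-f(x)\ge\langle x^*,y-x\rangle\ \forall y\}$, $N_A(x)$ the normal cone of convex analysis. Uniform lower semicontinuity: for a nonempty index set $T$ and functions $g_t$ (here the listed collection), let $\mathcal{F}(T)$ be the finite subsets of $T$ directed by inclusion, $\limsup_{S\uparrow T}\alpha_S:=\inf_{S_0}\sup_{S\supset S_0}\alpha_S$, $\liminf_{S\uparrow T}\alpha_S:=\sup_{S_0}\inf_{S\supset S_0}\alpha_S$ over $S,S_0\in\mathcal{F}(T)$; $\big(\overline{\sum_{t\in T}}g_t\big)(x):=\limsup_{S\uparrow T}\sum_{t\in S}g_t(x)$; for $U\subset X$, $\Lambda_U(\{g_t\}):=\liminf_{S\uparrow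 T}\lim_{\delta\downarrow0}\inf\{\sum_{t\in S}g_t(x_t): x_t\in U,\ \operatorname{diam}\{x_t\}_{t\in S}<\delta\}$. The collection is uniformly lower semicontinuous on $U$ if $\inf_U\overline{\sum_{t\in T}}g_t\le\Lambda_U(\{g_t\})$. *)

theory Defs
  imports "HOL-Analysis.Analysis"
begin

text \<open>Extended-real conventions of the paper: 0 * (+inf) = +inf and (+inf) - (+inf) = +inf.\<close>

definition emul :: "real \<Rightarrow> ereal \<Rightarrow> ereal" where
  "emul c a = (if a = \<infinity> then \<infinity> else ereal c * a)"

definition esub :: "ereal \<Rightarrow> ereal \<Rightarrow> ereal" where
  "esub a b = (if a = \<infinity> \<and> b = \<infinity> then \<infinity> else a - b)"

definition epos :: "ereal \<Rightarrow> ereal" where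
  "epos a = max a 0"

definition edom :: "('a \<Rightarrow> ereal) \<Rightarrow> 'a set" where
  "edom f = {x. f x < \<infinity>}"

definition proper_convex :: "('a::real_vector \<Rightarrow> ereal) \<Rightarrow> bool" where
  "proper_convex f \<longleftrightarrow> (\<forall>x. f x \<noteq> -\<infinity>) \<and> (\<exists>x. f x \<noteq> \<infinity>) \<and>
     (\<forall>x y. \<forall>t\<in>{0<..<1}. f ((1 - t) *\<^sub>R x + t *\<^sub>R y) \<le> ereal (1 - t) * f x + ereal t * f y)"

definition lsc_at :: "'a::topological_space \<Rightarrow> ('a \<Rightarrow> ereal) \<Rightarrow> bool" where
  "lsc_at x f \<longleftrightarrow> (\<forall>y < f x. eventually (\<lambda>z. y < f z) (at x))"

definition fsubdiff :: "('a::real_normed_vector \<Rightarrow> ereal) \<Rightarrow> 'a \<Rightarrow> ('a \<Rightarrow>\<^sub>L real) set" where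
  "fsubdiff f x = {x'. \<forall>y. ereal (blinfun_apply x' (y - x)) \<le> esub (f y) (f x)}"

definition normal_cone :: "'a::real_normed_vector set \<Rightarrow> 'a \<Rightarrow> ('a \<Rightarrow>\<^sub>L real) set" where
  "normal_cone A x = (if x \<in> A then {x'. \<forall>y\<in>A. blinfun_apply x' (y - x) \<le> 0} else {})"

definition scaled_subdiff :: "real \<Rightarrow> ('a::real_normed_vector \<Rightarrow> ereal) \<Rightarrow> 'a \<Rightarrow> ('a \<Rightarrow>\<^sub>L real) set" where
  "scaled_subdiff c f x = (if c = 0 then normal_cone (edom f) x else (\<lambda>x'. c *\<^sub>R x') ` fsubdiff f x)"

text \<open>Nonnegative bounded sequences (ell-infinity plus); index 0 is not used.\<close>

definition linf_plus :: "(nat \<Rightarrow> real) \<Rightarrow> bool" where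
  "linf_plus l \<longleftrightarrow> (\<forall>k. 0 \<le> l k) \<and> bounded (range l)"

text \<open>Lagrangian of (D_m); f 0 is the objective, f k (k >= 1) the constraints.\<close>

definition lagr :: "(nat \<Rightarrow> 'a \<Rightarrow> ereal) \<Rightarrow> nat \<Rightarrow> (nat \<Rightarrow> real) \<Rightarrow> 'a \<Rightarrow> ereal" where
  "lagr f m l x = f 0 x + (\<Sum>k\<in>{1..m}. emul (l k) (f k x))
      + (\<Sum>k. if m < k then emul (l k) (epos (f k x)) else 0)"

definition dual_solution :: "(nat \<Rightarrow> 'a \<Rightarrow> ereal) \<Rightarrow> nat \<Rightarrow> (nat \<Rightarrow> real) \<Rightarrow> bool" where
  "dual_solution f m l \<longleftrightarrow> linf_plus l \<and>
     (\<forall>l'. linf_plus l' \<longrightarrow> (INF x. lagr f m l' x) \<le> (INF x. lagr f m l x))"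

text \<open>Uniform lower semicontinuity of a collection g indexed by nat, on a set U.
  Limits over finite subsets directed by inclusion; lim_{delta -> 0+} of the
  (monotone) infimum is written as its supremum over delta > 0.\<close>

definition limsup_fin :: "(nat set \<Rightarrow> ereal) \<Rightarrow> ereal" where
  "limsup_fin a = (INF S0\<in>{S. finite S}. SUP S\<in>{S. finite S \<and> S0 \<subseteq> S}. a S)"

definition liminf_fin :: "(nat set \<Rightarrow> ereal) \<Rightarrow> ereal" where
  "liminf_fin a = (SUP S0\<in>{S. finite S}. INF S\<in>{S. finite S \<and> S0 \<subseteq> S}. a S)"

definition upper_sum :: "(nat \<Rightarrow> 'a \<Rightarrow> ereal) \<Rightarrow> 'a \<Rightarrow> ereal" where
  "upper_sum g x = limsup_fin (\<lambda>S. \<Sum>t\<in>S. g t x)"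

definition Lambda_U :: "'a::metric_space set \<Rightarrow> (nat \<Rightarrow> 'a \<Rightarrow> ereal) \<Rightarrow> ereal" where
  "Lambda_U U g = liminf_fin (\<lambda>S. SUP \<delta>\<in>{0<..}.
      INF xs\<in>{xs. (\<forall>t\<in>S. xs t \<in> U) \<and> diameter (xs ` S) < \<delta>}. \<Sum>t\<in>S. g t (xs t))"

definition uniformly_lsc :: "'a::metric_space set \<Rightarrow> (nat \<Rightarrow> 'a \<Rightarrow> ereal) \<Rightarrow> bool" where
  "uniformly_lsc U g \<longleftrightarrow> (INF x\<in>U. upper_sum g x) \<le> Lambda_U U g"

definition coll :: "(nat \<Rightarrow> 'a \<Rightarrow> ereal) \<Rightarrow> nat \<Rightarrow> (nat \<Rightarrow> real) \<Rightarrow> nat \<Rightarrow> 'a \<Rightarrow> ereal" where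
  "coll f m l k x = (if k = 0 then f 0 x
      else if k \<le> m then emul (l k) (f k x) else emul (l k) (epos (f k x)))"

end

theory Submission
  imports Defs "HOL-Probability.Discrete_Topology"
begin

text \<open>
  The Slater condition gives strong duality, so the Lagrangian at the dual solution is bounded below
  by the optimal value v; evaluating it at the primal solution yields complementary slackness.
  Uniform lower semicontinuity then turns this into an approximate decoupled minimum: for large n,
  the sum of the first n terms evaluated at nearby but different points stays above v minus a small
  constant. Penalising the mutual distances of the points and applying Ekeland's variational
  principle in the space of all families of points, with the supremum norm, produces an exact minimum
  of a separable convex function plus a finite convex function. The Moreau-Rockafellar sum rule splits
  it into subgradients of the individual functions, and testing with a common translation of all the
  points, which the penalty does not see, bounds the norm of their sum.
\<close>

section \<open>The Hahn-Banach theorem and the sum rule for convex functions\<close>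

lemma convex_on_INF:
  fixes \<Phi> :: "'p \<Rightarrow> 'a::real_vector \<Rightarrow> real"
  assumes ne: "A \<noteq> {}" and bdd: "\<And>x. bdd_below ((\<lambda>p. \<Phi> p x) ` A)"
    and joint: "\<And>p q x y t. p \<in> A \<Longrightarrow> q \<in> A \<Longrightarrow> 0 < t \<Longrightarrow> t < 1 \<Longrightarrow>
      \<exists>r\<in>A. \<Phi> r ((1 - t) *\<^sub>R x + t *\<^sub>R y) \<le> (1 - t) * \<Phi> p x + t * \<Phi> q y"
  shows "convex_on UNIV (\<lambda>x. INF p\<in>A. \<Phi> p x)"
proof (rule convex_onI)
  fix t :: real and x y :: 'a
  assume t: "0 < t" "t < 1"
  let ?I = "\<lambda>x. INF p\<in>A. \<Phi> p x"
  show "?I ((1 - t) *\<^sub>R x + t *\<^sub>R y) \<le> (1 - t) * ?I x + t * ?I y"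
  proof (rule field_le_epsilon)
    fix e :: real assume "0 < e"
    then have "\<exists>p\<in>A. \<Phi> p z < ?I z + e" for z
      by (simp flip: cINF_less_iff[OF ne bdd])
    then obtain p q where p: "p \<in> A" "\<Phi> p x < ?I x + e" and q: "q \<in> A" "\<Phi> q y < ?I y + e"
      by metis
    obtain r where r: "r \<in> A"
      "\<Phi> r ((1 - t) *\<^sub>R x + t *\<^sub>R y) \<le> (1 - t) * \<Phi> p x + t * \<Phi> q y"
      using joint[OF p(1) q(1) t] by blast
    have "?I ((1 - t) *\<^sub>R x + t *\<^sub>R y) \<le> \<Phi> r ((1 - t) *\<^sub>R x + t *\<^sub>R y)"
      by (rule cINF_lower[OF bdd r(1)])
    also have "\<dots> \<le> (1 - t) * \<Phi> p x + t * \<Phi> q y" by (rule r(2))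
    also have "\<dots> \<le> (1 - t) * (?I x + e) + t * (?I y + e)"
      using t p(2) q(2) by (intro add_mono mult_left_mono) auto
    finally show "?I ((1 - t) *\<^sub>R x + t *\<^sub>R y) \<le> (1 - t) * ?I x + t * ?I y + e"
      by (simp add: algebra_simps)
  qed
qed simp

lemma convex_on_INF_chain:
  fixes C :: "('a::real_vector \<Rightarrow> real) set"
  assumes "C \<noteq> {}" and conv: "\<And>r. r \<in> C \<Longrightarrow> convex_on UNIV r"
    and chain: "\<And>r s. r \<in> C \<Longrightarrow> s \<in> C \<Longrightarrow> r \<le> s \<or> s \<le> r"
    and bdd: "\<And>x. bdd_below ((\<lambda>r. r x) ` C)"
  shows "convex_on UNIV (\<lambda>x. INF r\<in>C. r x)"
proof (rule convex_on_INF[OF \<open>C \<noteq> {}\<close> bdd])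
  fix r s x y and t :: real
  assume "r \<in> C" "s \<in> C" and t: "0 < t" "t < 1"
  then obtain p where p: "p \<in> C" "p \<le> r" "p \<le> s" using chain[of r s] by blast
  have "p ((1 - t) *\<^sub>R x + t *\<^sub>R y) \<le> (1 - t) * p x + t * p y"
    using t by (intro convex_onD[OF conv[OF p(1)]]) auto
  also have "\<dots> \<le> (1 - t) * r x + t * s y"
    using t p by (intro add_mono mult_left_mono) (auto simp: le_fun_def)
  finally show "\<exists>p\<in>C. p ((1 - t) *\<^sub>R x + t *\<^sub>R y) \<le> (1 - t) * r x + t * s y"
    using p(1) by blast
qed

lemma convex_on_midpoint_le:
  fixes q :: "'a::real_vector \<Rightarrow> real"
  assumes "convex_on D q" "x \<in> D" "y \<in> D"
  shows "2 * q ((1/2) *\<^sub>R (x + y)) \<le> q x + q y"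
  using convex_onD[OF assms(1), of "1/2" x y] assms(2,3) by (simp add: scaleR_add_right)

lemma convex_on_reflect_le:
  fixes q :: "'a::real_vector \<Rightarrow> real"
  assumes "convex_on UNIV q" "q 0 = 0"
  shows "- q (- h) \<le> q h"
  using convex_on_midpoint_le[OF assms(1), of "-h" h] assms(2) by simp

text \<open>A minimal convex function vanishing at 0 is linear, so no extension from subspaces is needed.\<close>

definition minimal_convex :: "('a::real_vector \<Rightarrow> real) \<Rightarrow> bool" where
  "minimal_convex m \<longleftrightarrow> convex_on UNIV m \<and> m 0 = 0 \<and>
     (\<forall>r. convex_on UNIV r \<longrightarrow> r 0 = 0 \<longrightarrow> r \<le> m \<longrightarrow> r = m)"

lemma minimal_convex_minorant_exists:
  fixes q :: "'a::real_vector \<Rightarrow> real"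
  assumes q: "convex_on UNIV q" "q 0 = 0"
  shows "\<exists>m. minimal_convex m \<and> m \<le> q"
proof -
  define A where "A = {r. convex_on UNIV r \<and> r 0 = 0 \<and> r \<le> q}"
  have "\<exists>m\<in>A. \<forall>r\<in>A. r \<le> m \<longrightarrow> r = m"
  proof (rule predicate_Zorn[where P = "\<lambda>a b. b \<le> a"])
    show "partial_order_on A (relation_of (\<lambda>a b. b \<le> a) A)"
      by (rule partial_order_on_relation_ofI) auto
  next
    fix C assume "C \<in> Chains (relation_of (\<lambda>a b. b \<le> a) A)"
    then have CA: "C \<subseteq> A" and chain: "\<And>r s. r \<in> C \<Longrightarrow> s \<in> C \<Longrightarrow> r \<le> s \<or> s \<le> r"
      by (auto simp: Chains_def relation_of_def)
    show "\<exists>u\<in>A. \<forall>a\<in>C. u \<le> a"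
    proof (cases "C = {}")
      case True
      then show ?thesis using q by (auto simp: A_def)
    next
      case False
      define u where "u = (\<lambda>x. INF r\<in>C. r x)"
      have bdd: "bdd_below ((\<lambda>r. r x) ` C)" for x
      proof (rule bdd_belowI2)
        fix r assume "r \<in> C"
        then have "convex_on UNIV r" "r 0 = 0" "r (- x) \<le> q (- x)"
          using CA by (auto simp: A_def le_fun_def)
        then show "- q (- x) \<le> r x" using convex_on_reflect_le[of r x] by linarith
      qed
      have "convex_on UNIV u"
        unfolding u_def using CA chain
        by (intro convex_on_INF_chain[OF False _ _ bdd]) (auto simp: A_def)
      moreover have "u 0 = 0"
      proof -
        have "u 0 = (INF r\<in>C. 0)" unfolding u_def using CA by (intro INF_cong) (auto simp: A_def)
        then show ?thesis using False by simp
      qed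
      moreover have lower: "u \<le> r" if "r \<in> C" for r
        unfolding u_def le_fun_def using cINF_lower[OF bdd that] by blast
      moreover have "u \<le> q" using False CA lower by (fastforce simp: A_def)
      ultimately show ?thesis unfolding A_def by blast
    qed
  qed
  then show ?thesis by (force simp: A_def minimal_convex_def)
qed

lemma minimal_convexD:
  assumes "minimal_convex m" "convex_on UNIV r" "r 0 = 0" "\<And>x. r x \<le> m x"
  shows "r x = m x"
  using assms by (metis le_funI minimal_convex_def)

lemma minimal_convex_scaleR:
  assumes m: "minimal_convex m" and s: "0 \<le> s"
  shows "m (s *\<^sub>R x) = s * m x"
proof -
  have conv: "convex_on UNIV m" and m0: "m 0 = 0" using m by (auto simp: minimal_convex_def)
  have contraction: "m (c *\<^sub>R x) = c * m x" if c: "0 < c" "c \<le> 1" for c x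
  proof -
    define r where "r x = m (c *\<^sub>R x) / c" for x
    have "convex_on UNIV r"
    proof (rule convex_onI)
      fix t :: real and x y assume t: "0 < t" "t < 1"
      have "m ((1 - t) *\<^sub>R (c *\<^sub>R x) + t *\<^sub>R (c *\<^sub>R y)) \<le> (1 - t) * m (c *\<^sub>R x) + t * m (c *\<^sub>R y)"
        using t by (intro convex_onD[OF conv]) auto
      then show "r ((1 - t) *\<^sub>R x + t *\<^sub>R y) \<le> (1 - t) * r x + t * r y"
        using c by (simp add: r_def field_simps scaleR_add_right)
    qed simp
    moreover have "r 0 = 0" by (simp add: r_def m0)
    moreover have "r x \<le> m x" for x
      using convex_onD[OF conv, of c 0 x] c m0 by (simp add: r_def field_simps)
    ultimately have "r x = m x" by (rule minimal_convexD[OF m])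
    then show ?thesis using c by (simp add: r_def field_simps)
  qed
  consider "s = 0" | "0 < s" "s \<le> 1" | "1 < s" using s by linarith
  then show ?thesis
  proof cases
    case 3
    then show ?thesis using contraction[of "1/s" "s *\<^sub>R x"] by (simp add: field_simps)
  qed (auto simp: m0 contraction)
qed

lemma minimal_convex_subadditive:
  assumes "minimal_convex m"
  shows "m (x + y) \<le> m x + m y"
  using convex_on_midpoint_le[of UNIV m x y] minimal_convex_scaleR[OF assms, of "1/2" "x + y"] assms
  by (simp add: minimal_convex_def)

lemma minimal_convex_add:
  assumes m: "minimal_convex m"
  shows "m (x + a) = m x + m a"
proof -
  have conv: "convex_on UNIV m" and m0: "m 0 = 0" using m by (auto simp: minimal_convex_def)
  note hom = minimal_convex_scaleR[OF m]
  define r where "r x = (INF t\<in>{0..}. m (x + t *\<^sub>R a) - t * m a)" for x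
  have "- m (- x) \<le> m (x + t *\<^sub>R a) - t * m a" if "0 \<le> t" for x t
    using minimal_convex_subadditive[OF m, of "x + t *\<^sub>R a" "- x"] hom[OF that, of a] by simp
  then have bdd: "bdd_below ((\<lambda>t. m (x + t *\<^sub>R a) - t * m a) ` {0..})" for x
    by (intro bdd_belowI2[of _ "- m (- x)"]) auto
  have "convex_on UNIV r" unfolding r_def
  proof (rule convex_on_INF[OF _ bdd])
    fix p q t :: real and x y assume pq: "p \<in> {0..}" "q \<in> {0..}" and t: "0 < t" "t < 1"
    let ?s = "(1 - t) * p + t * q"
    have "(1 - t) *\<^sub>R x + t *\<^sub>R y + ?s *\<^sub>R a = (1 - t) *\<^sub>R (x + p *\<^sub>R a) + t *\<^sub>R (y + q *\<^sub>R a)"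
      by (simp add: algebra_simps)
    moreover have "m \<dots> \<le> (1 - t) * m (x + p *\<^sub>R a) + t * m (y + q *\<^sub>R a)"
      using t by (intro convex_onD[OF conv]) auto
    ultimately have "m ((1 - t) *\<^sub>R x + t *\<^sub>R y + ?s *\<^sub>R a) - ?s * m a
        \<le> (1 - t) * (m (x + p *\<^sub>R a) - p * m a) + t * (m (y + q *\<^sub>R a) - q * m a)"
      by (simp add: algebra_simps)
    moreover have "?s \<in> {0..}" using pq t by simp
    ultimately show "\<exists>s\<in>{0..}. m ((1 - t) *\<^sub>R x + t *\<^sub>R y + s *\<^sub>R a) - s * m a
        \<le> (1 - t) * (m (x + p *\<^sub>R a) - p * m a) + t * (m (y + q *\<^sub>R a) - q * m a)" by blast
  qed auto
  moreover have "r 0 = 0"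
  proof -
    have "r 0 = (INF t\<in>{0::real..}. 0)" unfolding r_def by (intro INF_cong) (auto simp: hom)
    then show ?thesis by simp
  qed
  moreover have "r x \<le> m x" for x
    unfolding r_def using cINF_lower[OF bdd, of 0 x] by simp
  ultimately have "r x = m x" by (rule minimal_convexD[OF m])
  then have "m x \<le> m (x + a) - m a"
    using cINF_lower[OF bdd, of 1 x] by (simp add: r_def)
  then show ?thesis using minimal_convex_subadditive[OF m, of x a] by linarith
qed

lemma minimal_convex_linear:
  assumes m: "minimal_convex m"
  shows "linear m"
proof (rule linearI)
  show "m (x + y) = m x + m y" for x y by (rule minimal_convex_add[OF m])
  show "m (s *\<^sub>R x) = s *\<^sub>R m x" for s x
  proof (cases "0 \<le> s")
    case False
    have "m (s *\<^sub>R x) + m ((- s) *\<^sub>R x) = 0"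
      using minimal_convex_add[OF m, of "s *\<^sub>R x" "(- s) *\<^sub>R x"] m by (simp add: minimal_convex_def)
    then show ?thesis using minimal_convex_scaleR[OF m, of "- s" x] False by simp
  qed (simp add: minimal_convex_scaleR[OF m])
qed

theorem hahn_banach_convex:
  fixes q :: "'a::real_vector \<Rightarrow> real"
  assumes "convex_on UNIV q" "q 0 = 0"
  shows "\<exists>y. linear y \<and> (\<forall>h. y h \<le> q h)"
  using minimal_convex_minorant_exists[OF assms] minimal_convex_linear by (metis le_funD)

lemma convex_on_infimal_convolution:
  fixes F H :: "'a::real_vector \<Rightarrow> real"
  assumes F: "convex_on D F" and H: "convex_on UNIV H" and ne: "D \<noteq> {}"
    and bdd: "\<And>h. bdd_below ((\<lambda>x. F x + H (x - h)) ` D)"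
  shows "convex_on UNIV (\<lambda>h. INF x\<in>D. F x + H (x - h))"
proof (rule convex_on_INF[OF ne bdd])
  fix x y h k and t :: real
  assume xy: "x \<in> D" "y \<in> D" and t: "0 < t" "t < 1"
  let ?w = "(1 - t) *\<^sub>R x + t *\<^sub>R y"
  have "?w - ((1 - t) *\<^sub>R h + t *\<^sub>R k) = (1 - t) *\<^sub>R (x - h) + t *\<^sub>R (y - k)"
    by (simp add: algebra_simps)
  moreover have "H \<dots> \<le> (1 - t) * H (x - h) + t * H (y - k)"
    using t by (intro convex_onD[OF H]) auto
  moreover have "F ?w \<le> (1 - t) * F x + t * F y"
    using t xy by (intro convex_onD[OF F]) auto
  ultimately have "F ?w + H (?w - ((1 - t) *\<^sub>R h + t *\<^sub>R k))
      \<le> (1 - t) * (F x + H (x - h)) + t * (F y + H (y - k))"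
    by (simp add: algebra_simps)
  moreover have "?w \<in> D" using convex_on_imp_convex[OF F] xy t by (intro convexD_alt) auto
  ultimately show "\<exists>w\<in>D. F w + H (w - ((1 - t) *\<^sub>R h + t *\<^sub>R k))
      \<le> (1 - t) * (F x + H (x - h)) + t * (F y + H (y - k))" by blast
qed

theorem convex_sum_rule:
  fixes F H :: "'a::real_vector \<Rightarrow> real"
  assumes F: "convex_on D F" and H: "convex_on UNIV H" and z: "z \<in> D"
    and min: "\<And>x. x \<in> D \<Longrightarrow> F z + H z \<le> F x + H x"
  shows "\<exists>y. linear y \<and> (\<forall>x\<in>D. F z + y (x - z) \<le> F x) \<and> (\<forall>x. H z - y (x - z) \<le> H x)"
proof -
  \<comment> \<open>A linear minorant of this infimal convolution is a subgradient of F (take h = x - z)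
    and its negative one of H (take x = z).\<close>
  define q where "q h = (INF x\<in>D. F x + H (x - h)) - (F z + H z)" for h
  have "F z + 2 * H z - H (z + h) \<le> F x + H (x - h)" if x: "x \<in> D" for x h
  proof -
    let ?w = "(1/2) *\<^sub>R (x + z)"
    have "?w \<in> D"
      using convexD_alt[OF convex_on_imp_convex[OF F] x z, of "1/2"] by (simp add: scaleR_add_right)
    moreover have "2 * H ?w \<le> H (x - h) + H (z + h)"
      using convex_on_midpoint_le[OF H, of "x - h" "z + h"] by simp
    ultimately show ?thesis using min[of ?w] convex_on_midpoint_le[OF F x z] by simp
  qed
  then have bdd: "bdd_below ((\<lambda>x. F x + H (x - h)) ` D)" for h by (rule bdd_belowI2)
  have "convex_on UNIV (\<lambda>h. INF x\<in>D. F x + H (x - h))"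
    using z by (intro convex_on_infimal_convolution[OF F H _ bdd]) auto
  then have "convex_on UNIV q"
    unfolding q_def[abs_def] by (intro convex_on_diff) (simp_all add: concave_on_const)
  moreover have "q 0 = 0"
  proof -
    have "(INF x\<in>D. F x + H (x - 0)) = F z + H z"
      using z min by (intro cInf_eq_minimum) auto
    then show ?thesis by (simp add: q_def)
  qed
  ultimately obtain y where lin: "linear y" and y: "\<And>h. y h \<le> q h" using hahn_banach_convex by blast
  have y_le: "F z + H z + y h \<le> F x + H (x - h)" if "x \<in> D" for x h
    using y[of h] cINF_lower[OF bdd that, of h] by (simp add: q_def)
  have "F z + y (x - z) \<le> F x" if "x \<in> D" for x
    using y_le[OF that, of "x - z"] by simp
  moreover have "H z - y (x - z) \<le> H x" for x
    using y_le[OF z, of "z - x"] by (simp add: linear_diff[OF lin])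
  ultimately show ?thesis using lin by blast
qed

section \<open>Ekeland's variational principle\<close>

definition descent_set :: "('b::metric_space \<Rightarrow> real) \<Rightarrow> real \<Rightarrow> 'b set \<Rightarrow> 'b \<Rightarrow> 'b set" where
  "descent_set \<phi> \<alpha> Z x = {y \<in> Z. \<phi> y + \<alpha> * dist x y \<le> \<phi> x}"

lemma descent_set_refl: "x \<in> Z \<Longrightarrow> x \<in> descent_set \<phi> \<alpha> Z x"
  by (simp add: descent_set_def)

lemma descent_set_trans:
  assumes "0 \<le> \<alpha>" "y \<in> descent_set \<phi> \<alpha> Z x"
  shows "descent_set \<phi> \<alpha> Z y \<subseteq> descent_set \<phi> \<alpha> Z x"
proof
  fix w assume "w \<in> descent_set \<phi> \<alpha> Z y"
  moreover have "\<alpha> * dist x w \<le> \<alpha> * dist x y + \<alpha> * dist y w"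
    using mult_left_mono[OF dist_triangle[of x w y] assms(1)] by (simp add: algebra_simps)
  ultimately show "w \<in> descent_set \<phi> \<alpha> Z x" using assms(2) by (auto simp: descent_set_def)
qed

lemma closed_descent_set:
  assumes closed_sublevel: "\<And>c. closed {x \<in> Z. \<phi> x \<le> c}"
  shows "closed (descent_set \<phi> \<alpha> Z x)"
  unfolding closed_sequential_limits
proof (intro allI impI, elim conjE)
  fix u w assume u: "\<forall>n. u n \<in> descent_set \<phi> \<alpha> Z x" and lim: "u \<longlonglongrightarrow> w"
  have limit: "w \<in> Z \<and> \<phi> w \<le> \<phi> x - \<alpha> * dist x w + e" if e: "0 < e" for e
  proof -
    have "(\<lambda>n. \<alpha> * dist x (u n)) \<longlonglongrightarrow> \<alpha> * dist x w" by (intro tendsto_intros lim)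
    then have "eventually (\<lambda>n. \<alpha> * dist x w - e < \<alpha> * dist x (u n)) sequentially"
      using e by (intro order_tendstoD) auto
    then have "eventually (\<lambda>n. u n \<in> {y \<in> Z. \<phi> y \<le> \<phi> x - \<alpha> * dist x w + e}) sequentially"
    proof (rule eventually_mono)
      fix n assume "\<alpha> * dist x w - e < \<alpha> * dist x (u n)"
      then show "u n \<in> {y \<in> Z. \<phi> y \<le> \<phi> x - \<alpha> * dist x w + e}"
        using u[rule_format, of n] by (simp add: descent_set_def)
    qed
    then show ?thesis using Lim_in_closed_set[OF closed_sublevel _ sequentially_bot lim] by simp
  qed
  then have "\<phi> w \<le> \<phi> x - \<alpha> * dist x w" by (meson field_le_epsilon)
  then show "w \<in> descent_set \<phi> \<alpha> Z x" using limit[of 1] by (simp add: descent_set_def)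
qed

lemma descent_sequence_exists:
  assumes bound: "\<And>x. x \<in> Z \<Longrightarrow> b \<le> \<phi> x" and x0: "x0 \<in> Z"
  shows "\<exists>s. s 0 = x0 \<and> (\<forall>n. s n \<in> Z \<and> s (Suc n) \<in> descent_set \<phi> \<alpha> Z (s n) \<and>
    (\<forall>w\<in>descent_set \<phi> \<alpha> Z (s n). \<phi> (s (Suc n)) \<le> \<phi> w + (1/2) ^ n))"
proof -
  let ?T = "descent_set \<phi> \<alpha> Z"
  have almost_min: "\<exists>y\<in>?T x. \<forall>w\<in>?T x. \<phi> y \<le> \<phi> w + e" if "x \<in> Z" "0 < e" for x e
  proof -
    have bdd: "bdd_below (\<phi> ` ?T x)"
      using bound by (intro bdd_belowI2[of _ b]) (auto simp: descent_set_def)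
    have "?T x \<noteq> {}" using descent_set_refl[OF that(1)] by blast
    moreover have "(INF y\<in>?T x. \<phi> y) < (INF y\<in>?T x. \<phi> y) + e" using that by simp
    ultimately obtain y where "y \<in> ?T x" "\<phi> y < (INF y\<in>?T x. \<phi> y) + e"
      using cINF_less_iff[OF _ bdd] by blast
    then show ?thesis using cINF_lower[OF bdd] by force
  qed
  have "\<exists>s. \<forall>n. (s n \<in> Z \<and> (n = 0 \<longrightarrow> s n = x0)) \<and>
      s (Suc n) \<in> ?T (s n) \<and> (\<forall>w\<in>?T (s n). \<phi> (s (Suc n)) \<le> \<phi> w + (1/2) ^ n)"
  proof (rule dependent_nat_choice)
    fix x and n :: nat assume "x \<in> Z \<and> (n = 0 \<longrightarrow> x = x0)"
    then show "\<exists>y. (y \<in> Z \<and> (Suc n = 0 \<longrightarrow> y = x0)) \<and>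
        y \<in> ?T x \<and> (\<forall>w\<in>?T x. \<phi> y \<le> \<phi> w + (1/2) ^ n)"
      using almost_min[of x "(1/2) ^ n"] by (auto simp: descent_set_def)
  qed (use x0 in blast)
  then show ?thesis by blast
qed

theorem ekeland_variational_principle:
  fixes \<phi> :: "'b::complete_space \<Rightarrow> real"
  assumes closed_sublevel: "\<And>c. closed {x \<in> Z. \<phi> x \<le> c}"
    and bound: "\<And>x. x \<in> Z \<Longrightarrow> b \<le> \<phi> x"
    and x0: "x0 \<in> Z" and \<alpha>: "0 < \<alpha>"
  shows "\<exists>z\<in>Z. \<phi> z + \<alpha> * dist x0 z \<le> \<phi> x0 \<and> (\<forall>x\<in>Z. \<phi> z \<le> \<phi> x + \<alpha> * dist z x)"
proof -
  let ?T = "descent_set \<phi> \<alpha> Z"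
  note trans = descent_set_trans[OF less_imp_le[OF \<alpha>], of _ \<phi> Z]
  obtain s where s0: "s 0 = x0" and sZ: "\<And>n. s n \<in> Z" and s_step: "\<And>n. s (Suc n) \<in> ?T (s n)"
    and s_min: "\<And>n w. w \<in> ?T (s n) \<Longrightarrow> \<phi> (s (Suc n)) \<le> \<phi> w + (1/2) ^ n"
    using descent_sequence_exists[of Z b \<phi> x0 \<alpha>, OF bound x0] by metis
  have "\<exists>z. (\<Inter>n. ?T (s n)) = {z}"
  proof (rule decreasing_closed_nest_sing)
    show "closed (?T (s n))" for n by (rule closed_descent_set[OF closed_sublevel])
    show "?T (s n) \<noteq> {}" for n using descent_set_refl[OF sZ] by blast
    show "?T (s n) \<subseteq> ?T (s m)" if "m \<le> n" for m n
      using trans[OF s_step] that by (rule lift_Suc_antimono_le)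
    fix e :: real assume e: "0 < e"
    then obtain n where n: "(1/2) ^ n < \<alpha> * e / 2"
      using real_arch_pow_inv[of "\<alpha> * e / 2" "1/2"] \<alpha> by auto
    have radius: "dist (s (Suc n)) w < e / 2" if w: "w \<in> ?T (s (Suc n))" for w
    proof -
      have "\<phi> (s (Suc n)) \<le> \<phi> w + (1/2) ^ n" using w trans[OF s_step] by (intro s_min) blast
      then have "\<alpha> * dist (s (Suc n)) w < \<alpha> * (e / 2)" using w n by (simp add: descent_set_def)
      then show ?thesis using \<alpha> by simp
    qed
    then have "dist x y < e" if "x \<in> ?T (s (Suc n))" "y \<in> ?T (s (Suc n))" for x y
      using that dist_triangle_half_r by blast
    then show "\<exists>n. \<forall>x\<in>?T (s n). \<forall>y\<in>?T (s n). dist x y < e" by blast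
  qed
  then obtain z where z: "(\<Inter>n. ?T (s n)) = {z}" by blast
  then have zT: "z \<in> ?T (s n)" for n by blast
  have "\<phi> z \<le> \<phi> x + \<alpha> * dist z x" if x: "x \<in> Z" for x
  proof (rule ccontr)
    assume less: "\<not> ?thesis"
    then have "x \<in> ?T z" using x by (simp add: descent_set_def)
    then have "x \<in> (\<Inter>n. ?T (s n))" using trans[OF zT] by blast
    then show False using z less by simp
  qed
  then show ?thesis using zT[of 0] by (auto simp: s0 descent_set_def)
qed

section \<open>Operations on convex functions\<close>

lemma convex_on_compose_linear:
  assumes A: "linear A" and f: "convex_on S f"
  shows "convex_on (A -` S) (\<lambda>x. f (A x))"
proof (rule convex_onI)
  show "convex (A -` S)" by (rule convex_linear_vimage[OF A convex_on_imp_convex[OF f]])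
qed (auto simp: linear_add[OF A] linear_scale[OF A] intro: convex_onD[OF f])

lemma convex_on_sum_functions:
  assumes "convex D" and "\<And>i. i \<in> I \<Longrightarrow> convex_on D (f i)"
  shows "convex_on D (\<lambda>x. \<Sum>i\<in>I. f i x)"
  using assms by (induction I rule: infinite_finite_induct) (auto simp: convex_on_const)

lemma convex_Collect_le:
  fixes g :: "'i \<Rightarrow> 'a::real_vector \<Rightarrow> real"
  assumes D: "convex D" and g: "\<And>i. i \<in> I \<Longrightarrow> convex_on D (g i)"
  shows "convex {x\<in>D. \<forall>i\<in>I. g i x \<le> c}"
  unfolding convex_alt
proof (intro ballI allI impI)
  fix x y u assume xy: "x \<in> {x\<in>D. \<forall>i\<in>I. g i x \<le> c}" "y \<in> {x\<in>D. \<forall>i\<in>I. g i x \<le> c}"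
    and u: "0 \<le> u \<and> u \<le> (1::real)"
  have "g i ((1 - u) *\<^sub>R x + u *\<^sub>R y) \<le> c" if "i \<in> I" for i
  proof -
    have "g i ((1 - u) *\<^sub>R x + u *\<^sub>R y) \<le> (1 - u) * g i x + u * g i y"
      using xy u by (intro convex_onD[OF g[OF that]]) auto
    also have "\<dots> \<le> c" using xy u that by (intro convex_bound_le) auto
    finally show ?thesis .
  qed
  then show "(1 - u) *\<^sub>R x + u *\<^sub>R y \<in> {x\<in>D. \<forall>i\<in>I. g i x \<le> c}"
    using xy u D by (auto simp: convex_alt)
qed

lemma convex_Collect_bdd_above:
  fixes g :: "'i \<Rightarrow> 'a::real_vector \<Rightarrow> real"
  assumes D: "convex D" and g: "\<And>i. i \<in> I \<Longrightarrow> convex_on D (g i)"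
  shows "convex {x\<in>D. bdd_above ((\<lambda>i. g i x) ` I)}"
proof -
  let ?B = "{x\<in>D. bdd_above ((\<lambda>i. g i x) ` I)}"
  have "(1 - u) *\<^sub>R x + u *\<^sub>R y \<in> ?B" if xy: "x \<in> ?B" "y \<in> ?B" and u: "0 \<le> u" "u \<le> 1" for x y u
  proof -
    obtain b c where "\<And>i. i \<in> I \<Longrightarrow> g i x \<le> b" "\<And>i. i \<in> I \<Longrightarrow> g i y \<le> c"
      using xy by (auto simp: bdd_above_def)
    then have "(1 - u) *\<^sub>R x + u *\<^sub>R y \<in> {x\<in>D. \<forall>i\<in>I. g i x \<le> max b c}"
      using xy u by (intro convexD_alt convex_Collect_le D g) (auto simp: le_max_iff_disj)
    then show ?thesis by (auto intro: bdd_aboveI2)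
  qed
  then show ?thesis by (auto simp: convex_alt)
qed

lemma convex_on_SUP:
  fixes g :: "'i \<Rightarrow> 'a::real_vector \<Rightarrow> real"
  assumes "I \<noteq> {}" and "convex D" and g: "\<And>i. i \<in> I \<Longrightarrow> convex_on D (g i)"
    and bdd: "\<And>x. x \<in> D \<Longrightarrow> bdd_above ((\<lambda>i. g i x) ` I)"
  shows "convex_on D (\<lambda>x. SUP i\<in>I. g i x)"
proof (rule convex_onI)
  fix t :: real and x y assume t: "0 < t" "t < 1" and xy: "x \<in> D" "y \<in> D"
  show "(SUP i\<in>I. g i ((1 - t) *\<^sub>R x + t *\<^sub>R y))
    \<le> (1 - t) * (SUP i\<in>I. g i x) + t * (SUP i\<in>I. g i y)"
  proof (rule cSUP_least[OF \<open>I \<noteq> {}\<close>])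
    fix i assume i: "i \<in> I"
    have "g i ((1 - t) *\<^sub>R x + t *\<^sub>R y) \<le> (1 - t) * g i x + t * g i y"
      using t xy by (intro convex_onD[OF g[OF i]]) auto
    also have "\<dots> \<le> (1 - t) * (SUP i\<in>I. g i x) + t * (SUP i\<in>I. g i y)"
      using t i xy by (intro add_mono mult_left_mono cSUP_upper bdd) auto
    finally show "g i ((1 - t) *\<^sub>R x + t *\<^sub>R y) \<le> \<dots>" .
  qed
qed fact

section \<open>Multipliers for convex inequality constraints\<close>

lemma constrained_min_slope_le:
  fixes F g :: "'a::real_vector \<Rightarrow> real"
  assumes F: "convex_on D F" and g: "convex_on D g"
    and opt: "\<And>x. x \<in> D \<Longrightarrow> g x \<le> 0 \<Longrightarrow> v \<le> F x"
    and x: "x \<in> D" "0 < g x" and y: "y \<in> D" "g y < 0"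
  shows "(v - F x) / g x \<le> (F y - v) / (- g y)"
proof -
  define t where "t = g x / (g x - g y)"
  have t: "0 \<le> t" "t \<le> 1" and t_compl: "1 - t = - g y / (g x - g y)"
    using x(2) y(2) by (auto simp: t_def field_simps)
  let ?z = "(1 - t) *\<^sub>R x + t *\<^sub>R y"
  have "g ?z \<le> (1 - t) * g x + t * g y" by (rule convex_onD[OF g t x(1) y(1)])
  also have "\<dots> = 0" unfolding t_compl by (simp add: t_def)
  finally have "v \<le> F ?z"
    using convex_on_imp_convex[OF F] x(1) y(1) t by (intro opt convexD_alt) auto
  also have "\<dots> \<le> (1 - t) * F x + t * F y" by (rule convex_onD[OF F t x(1) y(1)])
  also have "\<dots> = (- g y * F x + g x * F y) / (g x - g y)"
    unfolding t_compl by (simp add: t_def add_divide_distrib diff_divide_distrib)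
  finally have "v * (g x - g y) \<le> - g y * F x + g x * F y"
    using x(2) y(2) by (simp add: pos_le_divide_eq)
  then have "(v - F x) * (- g y) \<le> (F y - v) * g x" by (simp add: algebra_simps)
  moreover have "0 < - g y" using y(2) by simp
  ultimately show ?thesis
    using x(2) by (simp only: pos_divide_le_eq times_divide_eq_left pos_le_divide_eq)
qed

lemma convex_multiplier:
  fixes F g :: "'a::real_vector \<Rightarrow> real"
  assumes F: "convex_on D F" and g: "convex_on D g"
    and slater: "y \<in> D" "g y < 0"
    and opt: "\<And>x. x \<in> D \<Longrightarrow> g x \<le> 0 \<Longrightarrow> v \<le> F x"
  shows "\<exists>\<mu>\<ge>0. \<forall>x\<in>D. v \<le> F x + \<mu> * g x"
proof -
  define Y where "Y = {y\<in>D. g y < 0}"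
  define \<mu> where "\<mu> = (INF y\<in>Y. (F y - v) / (- g y))"
  have ne: "Y \<noteq> {}" using slater by (auto simp: Y_def)
  have nonneg: "0 \<le> (F y - v) / (- g y)" if "y \<in> Y" for y
    using that opt[of y] by (intro divide_nonneg_pos) (auto simp: Y_def)
  then have bdd: "bdd_below ((\<lambda>y. (F y - v) / (- g y)) ` Y)" by (rule bdd_belowI2)
  have "0 \<le> \<mu>" unfolding \<mu>_def by (rule cINF_greatest[OF ne nonneg])
  moreover have "v \<le> F x + \<mu> * g x" if x: "x \<in> D" for x
  proof -
    consider "g x < 0" | "g x = 0" | "0 < g x" by linarith
    then show ?thesis
    proof cases
      case 1
      then have "\<mu> \<le> (F x - v) / (- g x)"
        unfolding \<mu>_def using x by (intro cINF_lower[OF bdd]) (auto simp: Y_def)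
      then have "\<mu> * (- g x) \<le> F x - v" using 1 pos_le_divide_eq[of "- g x" \<mu> "F x - v"] by simp
      then show ?thesis by simp
    next
      case 2
      then show ?thesis using opt[OF x] by simp
    next
      case 3
      have "(v - F x) / g x \<le> \<mu>"
        unfolding \<mu>_def using constrained_min_slope_le[OF F g opt x 3]
        by (intro cINF_greatest[OF ne]) (simp add: Y_def)
      then show ?thesis using 3 by (simp add: field_simps)
    qed
  qed
  ultimately show ?thesis by blast
qed

lemma convex_multipliers:
  fixes F :: "'a::real_vector \<Rightarrow> real" and g :: "'i \<Rightarrow> 'a \<Rightarrow> real"
  assumes "finite K" and "convex_on D F" and "\<And>k. k \<in> K \<Longrightarrow> convex_on D (g k)"
    and "y \<in> D" and "\<And>k. k \<in> K \<Longrightarrow> g k y < 0"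
    and "\<And>x. x \<in> D \<Longrightarrow> (\<forall>k\<in>K. g k x \<le> 0) \<Longrightarrow> v \<le> F x"
  shows "\<exists>\<mu>. (\<forall>k. 0 \<le> \<mu> k) \<and> (\<forall>x\<in>D. v \<le> F x + (\<Sum>k\<in>K. \<mu> k * g k x))"
  using assms
proof (induction K arbitrary: F rule: finite_induct)
  case empty
  then show ?case by (intro exI[of _ "\<lambda>_. 0"]) auto
next
  case (insert k K)
  define D' where "D' = {x\<in>D. \<forall>j\<in>K. g j x \<le> 0}"
  have "convex D'"
    unfolding D'_def using insert.prems
    by (intro convex_Collect_le) (auto dest: convex_on_imp_convex)
  then have sub: "convex_on D' h" if "convex_on D h" for h
    using convex_on_subset[OF that, of D'] by (auto simp: D'_def)
  have "\<exists>c\<ge>0. \<forall>x\<in>D'. v \<le> F x + c * g k x"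
  proof (rule convex_multiplier)
    show "y \<in> D'" using insert.prems by (auto simp: D'_def less_imp_le)
    show "v \<le> F x" if "x \<in> D'" "g k x \<le> 0" for x
      using insert.prems(5)[of x] that by (auto simp: D'_def)
  qed (use insert.prems sub in auto)
  then obtain c where c: "0 \<le> c" "\<And>x. x \<in> D' \<Longrightarrow> v \<le> F x + c * g k x" by blast
  have "\<exists>\<mu>. (\<forall>k. 0 \<le> \<mu> k) \<and> (\<forall>x\<in>D. v \<le> (F x + c * g k x) + (\<Sum>k\<in>K. \<mu> k * g k x))"
    using insert.prems c
    by (intro insert.IH convex_on_add convex_on_cmul) (auto simp: D'_def)
  then obtain \<mu> where \<mu>: "\<And>k. 0 \<le> \<mu> k"
    "\<And>x. x \<in> D \<Longrightarrow> v \<le> F x + c * g k x + (\<Sum>j\<in>K. \<mu> j * g j x)" by blast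
  have "(\<Sum>j\<in>insert k K. (\<mu>(k := c)) j * g j x) = c * g k x + (\<Sum>j\<in>K. \<mu> j * g j x)" for x
    using insert.hyps by (auto intro: sum.cong)
  then show ?case using \<mu> c by (intro exI[of _ "\<mu>(k := c)"]) (auto simp: add.assoc)
qed

lemma convex_multipliers_with_sup:
  fixes F :: "'a::real_vector \<Rightarrow> real" and g :: "'i \<Rightarrow> 'a \<Rightarrow> real"
  assumes K: "finite K" and I: "I \<noteq> {}"
    and F: "convex_on D F" and g: "\<And>i. i \<in> K \<union> I \<Longrightarrow> convex_on D (g i)"
    and bdd: "\<And>x. x \<in> D \<Longrightarrow> bdd_above ((\<lambda>i. g i x) ` I)"
    and y: "y \<in> D" "s < 0" "\<And>i. i \<in> K \<union> I \<Longrightarrow> g i y \<le> s"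
    and opt: "\<And>x. x \<in> D \<Longrightarrow> (\<forall>i\<in>K \<union> I. g i x \<le> 0) \<Longrightarrow> v \<le> F x"
  shows "\<exists>\<mu> c. (\<forall>k. 0 \<le> \<mu> k) \<and> 0 \<le> c \<and>
    (\<forall>x\<in>D. v \<le> F x + (\<Sum>k\<in>K. \<mu> k * g k x) + c * (SUP i\<in>I. g i x))"
proof -
  let ?S = "\<lambda>x. SUP i\<in>I. g i x"
  define D' where "D' = {x\<in>D. \<forall>k\<in>K. g k x \<le> 0}"
  have convD: "convex D" by (rule convex_on_imp_convex[OF F])
  have S: "convex_on D ?S" using convD g by (intro convex_on_SUP[OF I] bdd) auto
  have "convex D'" unfolding D'_def using convD g by (intro convex_Collect_le) auto
  then have sub: "convex_on D' h" if "convex_on D h" for h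
    using convex_on_subset[OF that, of D'] by (auto simp: D'_def)
  have "\<exists>c\<ge>0. \<forall>x\<in>D'. v \<le> F x + c * ?S x"
  proof (rule convex_multiplier[OF sub[OF F] sub[OF S]])
    show "y \<in> D'" using y by (force simp: D'_def)
    have "?S y \<le> s" using y(3) by (intro cSUP_least[OF I]) auto
    then show "?S y < 0" using y(2) by simp
    fix x assume x: "x \<in> D'" "?S x \<le> 0"
    have "g i x \<le> 0" if "i \<in> I" for i
      using cSUP_upper[OF that bdd, of x] x by (auto simp: D'_def)
    then show "v \<le> F x" using x by (intro opt) (auto simp: D'_def)
  qed
  then obtain c where c: "0 \<le> c" "\<And>x. x \<in> D' \<Longrightarrow> v \<le> F x + c * ?S x" by blast
  have "\<exists>\<mu>. (\<forall>k. 0 \<le> \<mu> k) \<and> (\<forall>x\<in>D. v \<le> F x + c * ?S x + (\<Sum>k\<in>K. \<mu> k * g k x))"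
  proof (rule convex_multipliers[OF K _ _ y(1)])
    show "convex_on D (\<lambda>x. F x + c * ?S x)" by (intro convex_on_add convex_on_cmul F S c(1))
    show "g k y < 0" if "k \<in> K" for k using y(3)[of k] y(2) that by simp
  qed (use g c(2) in \<open>auto simp: D'_def\<close>)
  then show ?thesis using c(1) by (auto simp: algebra_simps)
qed

section \<open>Proper convex and lower semicontinuous functions\<close>

lemma proper_convex_not_MInfty: "proper_convex f \<Longrightarrow> f x \<noteq> -\<infinity>"
  by (simp add: proper_convex_def)

lemma proper_convexD:
  assumes "proper_convex f" "0 < t" "t < 1"
  shows "f ((1 - t) *\<^sub>R x + t *\<^sub>R y) \<le> ereal (1 - t) * f x + ereal t * f y"
  using assms by (simp add: proper_convex_def)

lemma proper_convex_real: "proper_convex f \<Longrightarrow> x \<in> edom f \<Longrightarrow> ereal (real_of_ereal (f x)) = f x"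
  by (cases "f x") (auto simp: edom_def dest: proper_convex_not_MInfty)

lemma proper_convex_imp_convex_on:
  assumes f: "proper_convex f"
  shows "convex_on (edom f) (\<lambda>x. real_of_ereal (f x))"
proof -
  have combination: "f ((1 - t) *\<^sub>R x + t *\<^sub>R y)
      \<le> ereal ((1 - t) * real_of_ereal (f x) + t * real_of_ereal (f y))"
    if "0 < t" "t < 1" and xy: "x \<in> edom f" "y \<in> edom f" for t x y
  proof -
    obtain a b where "f x = ereal a" "f y = ereal b" using proper_convex_real[OF f] xy by metis
    then show ?thesis using proper_convexD[OF f that(1,2), of x y] by simp
  qed
  have in_edom: "(1 - t) *\<^sub>R x + t *\<^sub>R y \<in> edom f"
    if "0 < t" "t < 1" "x \<in> edom f" "y \<in> edom f" for t x y
    using combination[OF that] by (auto simp: edom_def)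
  show ?thesis
  proof (rule convex_onI)
    fix t :: real and x y assume txy: "0 < t" "t < 1" "x \<in> edom f" "y \<in> edom f"
    show "real_of_ereal (f ((1 - t) *\<^sub>R x + t *\<^sub>R y))
      \<le> (1 - t) * real_of_ereal (f x) + t * real_of_ereal (f y)"
      using combination[OF txy] proper_convex_real[OF f in_edom[OF txy]] by (metis ereal_less_eq(3))
  next
    show "convex (edom f)" unfolding convex_alt
    proof (intro ballI allI impI)
      fix x y and u :: real assume "x \<in> edom f" "y \<in> edom f" "0 \<le> u \<and> u \<le> 1"
      then show "(1 - u) *\<^sub>R x + u *\<^sub>R y \<in> edom f"
        using in_edom[of u x y] by (cases "u = 0 \<or> u = 1") auto
    qed
  qed
qed

lemma proper_convex_ereal: "convex_on UNIV H \<Longrightarrow> proper_convex (\<lambda>x. ereal (H x))"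
  using convex_onD[of UNIV H] by (simp add: proper_convex_def)

lemma proper_convex_add:
  assumes f: "proper_convex f" and g: "proper_convex g" and z: "z \<in> edom f" "z \<in> edom g"
  shows "proper_convex (\<lambda>x. f x + g x)"
  unfolding proper_convex_def
proof (intro conjI allI ballI)
  show "f x + g x \<noteq> -\<infinity>" for x
    using proper_convex_not_MInfty[OF f, of x] proper_convex_not_MInfty[OF g, of x] by simp
  show "\<exists>x. f x + g x \<noteq> \<infinity>" using z by (auto simp: edom_def intro!: exI[of _ z])
  fix x y and t :: real assume t: "t \<in> {0<..<1}"
  have "f ((1 - t) *\<^sub>R x + t *\<^sub>R y) + g ((1 - t) *\<^sub>R x + t *\<^sub>R y)
      \<le> (ereal (1 - t) * f x + ereal t * f y) + (ereal (1 - t) * g x + ereal t * g y)"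
    using t by (intro add_mono proper_convexD f g) auto
  also have "\<dots> = ereal (1 - t) * (f x + g x) + ereal t * (f y + g y)"
    using t by (simp add: ereal_pos_distrib ac_simps)
  finally show "f ((1 - t) *\<^sub>R x + t *\<^sub>R y) + g ((1 - t) *\<^sub>R x + t *\<^sub>R y)
      \<le> ereal (1 - t) * (f x + g x) + ereal t * (f y + g y)" .
qed

lemma edom_sum:
  assumes "finite I"
  shows "edom (\<lambda>x. \<Sum>i\<in>I. f i x) = (\<Inter>i\<in>I. edom (f i))"
  using assms by (auto simp: edom_def sum_Pinfty less_top)

lemma proper_convex_sum:
  assumes "finite I" and "\<And>i. i \<in> I \<Longrightarrow> proper_convex (f i)" and "\<And>i. i \<in> I \<Longrightarrow> z \<in> edom (f i)"
  shows "proper_convex (\<lambda>x. \<Sum>i\<in>I. f i x)"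
  using assms
proof (induction I rule: finite_induct)
  case empty
  show ?case by (simp add: proper_convex_def)
next
  case (insert i I)
  have "proper_convex (\<lambda>x. f i x + (\<Sum>j\<in>I. f j x))"
    using insert by (intro proper_convex_add[where z = z]) (auto simp: edom_sum)
  then show ?case using insert.hyps by simp
qed

lemma proper_convex_compose_linear:
  assumes f: "proper_convex f" and A: "linear A" and z: "A z \<in> edom f"
  shows "proper_convex (\<lambda>x. f (A x))"
  using assms by (auto simp: proper_convex_def edom_def linear_add linear_scale)

lemma edom_emul:
  assumes "0 \<le> c"
  shows "edom (\<lambda>x. emul c (f x)) = edom f"
proof -
  have "emul c a < \<infinity> \<longleftrightarrow> a < \<infinity>" for a
    using assms by (cases a) (auto simp: emul_def)
  then show ?thesis by (simp add: edom_def)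
qed

lemma emul_not_MInfty: "a \<noteq> -\<infinity> \<Longrightarrow> emul c a \<noteq> -\<infinity>"
  by (cases a) (auto simp: emul_def)

lemma emul_nonpos: "0 \<le> c \<Longrightarrow> a \<le> 0 \<Longrightarrow> emul c a \<le> 0"
  by (cases "c = 0"; cases a) (auto simp: emul_def mult_nonneg_nonpos)

lemma emul_ereal [simp]: "emul c (ereal r) = ereal (c * r)"
  by (simp add: emul_def)

lemma emul_PInfty [simp]: "emul c \<infinity> = \<infinity>"
  by (simp add: emul_def)

lemma proper_convex_emul:
  assumes f: "proper_convex f" and c: "0 \<le> c"
  shows "proper_convex (\<lambda>x. emul c (f x))"
  unfolding proper_convex_def
proof (intro conjI allI ballI)
  show not_MInfty: "emul c (f x) \<noteq> -\<infinity>" for x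
    by (rule emul_not_MInfty[OF proper_convex_not_MInfty[OF f]])
  show "\<exists>x. emul c (f x) \<noteq> \<infinity>"
    using f c by (auto simp: proper_convex_def emul_def)
  fix x y and t :: real assume t: "t \<in> {0<..<1}"
  show "emul c (f ((1 - t) *\<^sub>R x + t *\<^sub>R y))
    \<le> ereal (1 - t) * emul c (f x) + ereal t * emul c (f y)"
  proof (cases "x \<in> edom f \<and> y \<in> edom f")
    case True
    then obtain a b where "f x = ereal a" "f y = ereal b"
      using proper_convex_real[OF f] by metis
    moreover obtain d where "f ((1 - t) *\<^sub>R x + t *\<^sub>R y) = ereal d" "d \<le> (1 - t) * a + t * b"
      using proper_convexD[OF f, of t x y] proper_convex_not_MInfty[OF f] t calculation
      by (cases "f ((1 - t) *\<^sub>R x + t *\<^sub>R y)") auto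
    ultimately show ?thesis
      using mult_left_mono[of d "(1 - t) * a + t * b" c] c by (simp add: algebra_simps)
  next
    case False
    then have "f x = \<infinity> \<or> f y = \<infinity>" by (auto simp: edom_def)
    then have "ereal (1 - t) * emul c (f x) + ereal t * emul c (f y) = \<infinity>"
      using t not_MInfty[of x] not_MInfty[of y] by (cases "emul c (f x)"; cases "emul c (f y)") auto
    then show ?thesis by (simp only: ereal_less_eq)
  qed
qed

lemma epos_ereal [simp]: "epos (ereal r) = ereal (max r 0)"
  by (simp add: epos_def max_def)

lemma epos_PInfty [simp]: "epos \<infinity> = \<infinity>"
  by (simp add: epos_def)

lemma epos_nonneg: "0 \<le> epos a" and epos_ge: "a \<le> epos a"
  by (auto simp: epos_def)

lemma proper_convex_epos:
  assumes f: "proper_convex f"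
  shows "proper_convex (\<lambda>x. epos (f x))"
  unfolding proper_convex_def
proof (intro conjI allI ballI)
  show "epos (f x) \<noteq> -\<infinity>" for x using epos_nonneg[of "f x"] by auto
  show "\<exists>x. epos (f x) \<noteq> \<infinity>"
    using f by (auto simp: proper_convex_def epos_def max_def)
  fix x y and t :: real assume t: "t \<in> {0<..<1}"
  have "f ((1 - t) *\<^sub>R x + t *\<^sub>R y) \<le> ereal (1 - t) * f x + ereal t * f y"
    using t by (intro proper_convexD[OF f]) auto
  also have "\<dots> \<le> ereal (1 - t) * epos (f x) + ereal t * epos (f y)"
    using t by (intro add_mono ereal_mult_left_mono epos_ge) auto
  finally show "epos (f ((1 - t) *\<^sub>R x + t *\<^sub>R y))
    \<le> ereal (1 - t) * epos (f x) + ereal t * epos (f y)"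
    using t epos_nonneg[of "f x"] epos_nonneg[of "f y"] by (simp add: epos_def[of "f (_ + _)"])
qed

lemma lsc_at_iff_Liminf: "lsc_at x f \<longleftrightarrow> f x \<le> Liminf (nhds x) f"
  unfolding lsc_at_def le_Liminf_iff eventually_nhds_conv_at by blast

lemma lsc_at_continuous:
  assumes "isCont f x"
  shows "lsc_at x (\<lambda>x. ereal (f x))"
proof -
  have "((\<lambda>x. ereal (f x)) \<longlongrightarrow> ereal (f x)) (at x)"
    using assms by (simp add: isCont_def)
  then show ?thesis unfolding lsc_at_def using order_tendstoD(1) by blast
qed

lemma lsc_at_add:
  assumes f: "lsc_at x f" and g: "lsc_at x g" and ninf: "f x \<noteq> -\<infinity>" "g x \<noteq> -\<infinity>"
  shows "lsc_at x (\<lambda>z. f z + g z)"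
  unfolding lsc_at_def
proof (intro allI impI)
  fix y assume "y < f x + g x"
  then have "y - f x < g x" using ninf by (cases y; cases "f x"; cases "g x") auto
  then obtain b where b: "y - f x < b" "b < g x" using dense by blast
  then have real: "\<bar>b\<bar> \<noteq> \<infinity>" by auto
  then have "y - b < f x" using b ninf by (cases y; cases "f x"; cases b) auto
  then have "eventually (\<lambda>z. y - b < f z) (at x)" "eventually (\<lambda>z. b < g z) (at x)"
    using f g b(2) unfolding lsc_at_def by auto
  then show "eventually (\<lambda>z. y < f z + g z) (at x)"
  proof eventually_elim
    case (elim z)
    then have "(y - b) + b < f z + g z" by (rule ereal_add_strict_mono2)
    then show ?case using real by (cases y; cases b) auto
  qed
qed

lemma sum_ereal_not_MInfty:
  fixes g :: "'i \<Rightarrow> ereal"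
  assumes "\<And>k. k \<in> A \<Longrightarrow> g k \<noteq> -\<infinity>"
  shows "sum g A \<noteq> -\<infinity>"
  using assms by (induction A rule: infinite_finite_induct) auto

lemma lsc_at_sum:
  assumes "finite I" and "\<And>i. i \<in> I \<Longrightarrow> lsc_at x (f i)" and "\<And>i. i \<in> I \<Longrightarrow> f i x \<noteq> -\<infinity>"
  shows "lsc_at x (\<lambda>z. \<Sum>i\<in>I. f i z)"
  using assms
proof (induction I rule: finite_induct)
  case empty
  show ?case by (simp add: lsc_at_def)
next
  case (insert i I)
  have "lsc_at x (\<lambda>z. f i z + (\<Sum>j\<in>I. f j z))"
    using insert by (intro lsc_at_add sum_ereal_not_MInfty) auto
  then show ?case using insert.hyps by simp
qed

lemma lsc_at_compose:
  assumes f: "lsc_at (A x) f" and A: "isCont A x"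
  shows "lsc_at x (\<lambda>x. f (A x))"
  unfolding lsc_at_def
proof (intro allI impI)
  fix y assume "y < f (A x)"
  then have "eventually (\<lambda>z. y < f z) (nhds (A x))"
    using f by (simp add: lsc_at_iff_Liminf le_Liminf_iff)
  then show "eventually (\<lambda>z. y < f (A z)) (at x)"
    using A by (auto simp: isCont_def filterlim_iff)
qed

lemma closed_lsc_sublevel:
  assumes S: "closed S" and lsc: "\<And>x. x \<in> S \<Longrightarrow> lsc_at x f"
  shows "closed {x \<in> S. f x \<le> c}"
proof -
  have "eventually (\<lambda>z. z \<notin> {x \<in> S. f x \<le> c}) (nhds x)" if x: "x \<notin> {x \<in> S. f x \<le> c}" for x
  proof (cases "x \<in> S")
    case True
    then have "eventually (\<lambda>z. c < f z) (nhds x)"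
      using lsc[OF True] x by (simp add: lsc_at_iff_Liminf le_Liminf_iff not_le)
    then show ?thesis by (rule eventually_mono) auto
  next
    case False
    then have "eventually (\<lambda>z. z \<in> - S) (nhds x)" using S by (intro eventually_nhds_in_open) auto
    then show ?thesis by (rule eventually_mono) auto
  qed
  then show ?thesis
    unfolding closed_def by (subst open_subopen) (auto simp: eventually_nhds subset_eq)
qed

section \<open>Fenchel subdifferentials\<close>

lemma fsubdiff_edom_iff:
  fixes f :: "'a::real_normed_vector \<Rightarrow> ereal"
  assumes f: "proper_convex f" and z: "z \<in> edom f"
  shows "y \<in> fsubdiff f z \<longleftrightarrow>
    (\<forall>x\<in>edom f. real_of_ereal (f z) + blinfun_apply y (x - z) \<le> real_of_ereal (f x))"
proof -
  obtain b where b: "f z = ereal b" using proper_convex_real[OF f z] by metis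
  have "ereal (y (x - z)) \<le> esub (f x) (f z) \<longleftrightarrow>
      (x \<in> edom f \<longrightarrow> b + y (x - z) \<le> real_of_ereal (f x))" for x
    using proper_convex_not_MInfty[OF f, of x] b by (cases "f x") (auto simp: esub_def edom_def)
  then show ?thesis using b by (auto simp: fsubdiff_def)
qed

lemma fsubdiff_emul_subset:
  fixes f :: "'a::real_normed_vector \<Rightarrow> ereal"
  assumes f: "proper_convex f" and c: "0 \<le> c" and x: "x \<in> edom f"
  shows "fsubdiff (\<lambda>x. emul c (f x)) x \<subseteq> scaled_subdiff c f x"
proof
  fix y assume "y \<in> fsubdiff (\<lambda>x. emul c (f x)) x"
  moreover have "real_of_ereal (emul c (f z)) = c * real_of_ereal (f z)" if "z \<in> edom f" for z
    using that by (auto simp: emul_def edom_def)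
  ultimately have minorant: "c * real_of_ereal (f x) + y (z - x) \<le> c * real_of_ereal (f z)"
    if "z \<in> edom f" for z
    using x that by (simp add: fsubdiff_edom_iff proper_convex_emul f c edom_emul)
  show "y \<in> scaled_subdiff c f x"
  proof (cases "c = 0")
    case True
    then show ?thesis using minorant x by (auto simp: scaled_subdiff_def normal_cone_def)
  next
    case False
    have "real_of_ereal (f x) + (y /\<^sub>R c) (z - x) \<le> real_of_ereal (f z)" if "z \<in> edom f" for z
      using minorant[OF that] c False by (simp add: blinfun.scaleR_left field_simps)
    then have "y /\<^sub>R c \<in> fsubdiff f x" by (simp add: fsubdiff_edom_iff f x)
    moreover have "y = c *\<^sub>R (y /\<^sub>R c)" using False by simp
    ultimately show ?thesis using False unfolding scaled_subdiff_def by (simp add: rev_image_eqI)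
  qed
qed

lemma bounded_linear_bounded_above_near_0:
  fixes y :: "'a::real_normed_vector \<Rightarrow> real"
  assumes y: "linear y" and \<delta>: "0 < \<delta>" and bound: "\<And>h. norm h \<le> \<delta> \<Longrightarrow> y h \<le> 1"
  shows "bounded_linear y"
proof -
  have upper: "y h \<le> norm h * (1 / \<delta>)" for h
  proof (cases "h = 0")
    case False
    have "y ((\<delta> / norm h) *\<^sub>R h) \<le> 1" using \<delta> False by (intro bound) simp
    then show ?thesis using \<delta> False by (simp add: linear_scale[OF y] field_simps)
  qed (simp add: linear_0[OF y])
  have "norm (y h) \<le> norm h * (1 / \<delta>)" for h
    using upper[of h] upper[of "- h"] by (simp add: linear_neg[OF y] abs_le_iff)
  then show ?thesis
    using y by (intro bounded_linear_intro[where K = "1 / \<delta>"]) (auto simp: linear_add linear_scale)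
qed

theorem fsubdiff_sum_rule:
  fixes f :: "'a::real_normed_vector \<Rightarrow> ereal" and H :: "'a \<Rightarrow> real"
  assumes f: "proper_convex f" and z: "z \<in> edom f"
    and H: "convex_on UNIV H" and cont: "isCont H z"
    and min: "\<And>x. x \<in> edom f \<Longrightarrow> real_of_ereal (f z) + H z \<le> real_of_ereal (f x) + H x"
  shows "\<exists>y\<in>fsubdiff f z. \<forall>h. H z - blinfun_apply y h \<le> H (z + h)"
proof -
  obtain y where lin: "linear y"
    and y_f: "\<And>x. x \<in> edom f \<Longrightarrow> real_of_ereal (f z) + y (x - z) \<le> real_of_ereal (f x)"
    and y_H: "\<And>x. H z - y (x - z) \<le> H x"
    using convex_sum_rule[OF proper_convex_imp_convex_on[OF f] H z min] by blast
  obtain \<delta> where \<delta>: "0 < \<delta>" "\<And>x. dist x z < \<delta> \<Longrightarrow> dist (H x) (H z) < 1"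
    using cont unfolding continuous_at_eps_delta by (meson zero_less_one)
  have "bounded_linear y"
  proof (rule bounded_linear_bounded_above_near_0[OF lin])
    show "0 < \<delta> / 2" using \<delta> by simp
    fix h :: 'a assume "norm h \<le> \<delta> / 2"
    then have "dist (H (z - h)) (H z) < 1" using \<delta> by (intro \<delta>(2)) (simp add: dist_norm)
    then show "y h \<le> 1" using y_H[of "z - h"] by (simp add: linear_neg[OF lin] dist_real_def)
  qed
  then obtain y' :: "'a \<Rightarrow>\<^sub>L real" where y': "blinfun_apply y' = y"
    using bounded_linear_Blinfun_apply by blast
  have "y' \<in> fsubdiff f z" using y_f by (simp add: fsubdiff_edom_iff[OF f z] y')
  moreover have "H z - y' h \<le> H (z + h)" for h using y_H[of "z + h"] by (simp add: y')
  ultimately show ?thesis by blast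
qed

section \<open>Almost minimisers of proper convex functions\<close>

lemma convex_on_local_min_imp_min:
  fixes F :: "'a::real_normed_vector \<Rightarrow> real"
  assumes F: "convex_on D F" and z: "z \<in> D" and e: "0 < e"
    and local_min: "\<And>x. x \<in> D \<Longrightarrow> dist z x < e \<Longrightarrow> F z \<le> F x"
    and x: "x \<in> D"
  shows "F z \<le> F x"
proof -
  have "0 < e / (dist z x + 1)" using e by (simp add: add_nonneg_pos)
  then obtain t where t: "0 < t" "t < 1" "t < e / (dist z x + 1)"
    using field_lbound_gt_zero[of 1] by auto
  let ?w = "(1 - t) *\<^sub>R z + t *\<^sub>R x"
  have "t * dist z x < e" using t by (simp add: pos_less_divide_eq add_nonneg_pos distrib_left)
  moreover have "z - ?w = t *\<^sub>R (z - x)" by (simp add: algebra_simps)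
  ultimately have "dist z ?w < e" using t by (simp add: dist_norm)
  moreover have "?w \<in> D" using convexD_alt[OF convex_on_imp_convex[OF F] z x] t by simp
  ultimately have "F z \<le> F ?w" by (rule local_min[rotated])
  also have "\<dots> \<le> (1 - t) * F z + t * F x" using t z x by (intro convex_onD[OF F]) auto
  finally have "t * F z \<le> t * F x" by (simp add: algebra_simps)
  then show ?thesis using t by simp
qed

lemma proper_convex_bounded_below:
  fixes f :: "'a::real_normed_vector \<Rightarrow> ereal"
  assumes f: "proper_convex f" and z: "z \<in> edom f" and lsc: "lsc_at z f" and r: "0 \<le> r"
  shows "\<exists>b. \<forall>x\<in>cball z r. ereal b \<le> f x"
proof -
  obtain a where a: "f z = ereal a" using proper_convex_real[OF f z] by metis
  have "eventually (\<lambda>x. ereal (a - 1) < f x) (nhds z)"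
    using lsc unfolding lsc_at_iff_Liminf le_Liminf_iff by (simp add: a)
  then obtain s where s: "0 < s" "\<And>x. dist x z < s \<Longrightarrow> ereal (a - 1) < f x"
    unfolding eventually_nhds_metric by blast
  define t where "t = s / (s + r + 1)"
  have t: "0 < t" "t < 1" "t * r < s"
    using s(1) r by (auto simp: t_def divide_less_eq distrib_left add_nonneg_pos)
  have "ereal (a - 1 / t) \<le> f x" if x: "x \<in> cball z r" for x
  proof (cases "x \<in> edom f")
    case True
    then obtain b where b: "f x = ereal b" using proper_convex_real[OF f] by metis
    let ?w = "(1 - t) *\<^sub>R z + t *\<^sub>R x"
    have "?w - z = t *\<^sub>R (x - z)" by (simp add: algebra_simps)
    then have "dist ?w z = t * dist z x" using t by (simp add: dist_norm norm_minus_commute)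
    also have "\<dots> \<le> t * r" using t x by simp
    finally have "ereal (a - 1) < f ?w" using t s(2) by simp
    also have "\<dots> \<le> ereal (1 - t) * f z + ereal t * f x" by (rule proper_convexD[OF f t(1,2)])
    finally have "a - 1 / t < b" using t by (simp add: a b field_simps)
    then show ?thesis by (simp add: b)
  next
    case False
    then show ?thesis by (simp add: edom_def)
  qed
  then show ?thesis by blast
qed

lemma ekeland_proper_convex:
  fixes f :: "'a::{real_normed_vector, complete_space} \<Rightarrow> ereal"
  assumes f: "proper_convex f" and c: "c \<in> edom f"
    and lsc: "\<And>x. x \<in> cball c r \<Longrightarrow> lsc_at x f"
    and pos: "0 < r" "0 < \<alpha>" "\<eta> < \<alpha> * r"
    and almost_min: "\<And>x. x \<in> cball c r \<Longrightarrow> f c \<le> f x + ereal \<eta>"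
  shows "\<exists>z\<in>ball c r \<inter> edom f. f z \<le> f c \<and>
    (\<forall>x\<in>edom f. real_of_ereal (f z) \<le> real_of_ereal (f x) + \<alpha> * dist z x)"
proof -
  define \<phi> where "\<phi> x = real_of_ereal (f x)" for x
  have f_\<phi>: "f x = ereal (\<phi> x)" if "x \<in> edom f" for x
    using proper_convex_real[OF f that] by (simp add: \<phi>_def)
  have lower: "\<phi> c - \<eta> \<le> \<phi> x" if "x \<in> cball c r \<inter> edom f" for x
    using almost_min[of x] that by (simp add: f_\<phi> c)
  have closed: "closed {x \<in> cball c r \<inter> edom f. \<phi> x \<le> a}" for a
  proof -
    have "x \<in> edom f \<and> \<phi> x \<le> a \<longleftrightarrow> f x \<le> ereal a" for x
      using f_\<phi>[of x] by (cases "x \<in> edom f") (auto simp: edom_def)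
    then have "{x \<in> cball c r \<inter> edom f. \<phi> x \<le> a} = {x \<in> cball c r. f x \<le> ereal a}" by blast
    then show ?thesis using closed_lsc_sublevel[OF closed_cball lsc] by simp
  qed
  obtain z where z: "z \<in> cball c r \<inter> edom f" and descent: "\<phi> z + \<alpha> * dist c z \<le> \<phi> c"
    and min: "\<And>x. x \<in> cball c r \<inter> edom f \<Longrightarrow> \<phi> z \<le> \<phi> x + \<alpha> * dist z x"
    using ekeland_variational_principle[OF closed lower _ pos(2), of c] c pos(1) by auto
  have "\<alpha> * dist c z < \<alpha> * r" using descent lower[OF z] pos by linarith
  then have dist: "dist c z < r" using pos by simp
  have "\<phi> z + \<alpha> * dist z z \<le> \<phi> x + \<alpha> * dist z x" if x: "x \<in> edom f" for x
  proof (rule convex_on_local_min_imp_min[OF _ _ _ _ x])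
    show "convex_on (edom f) (\<lambda>x. \<phi> x + \<alpha> * dist z x)"
      unfolding \<phi>_def using proper_convex_imp_convex_on[OF f] pos
      by (intro convex_on_add convex_on_cmul convex_on_dist) (auto dest: convex_on_imp_convex)
    show "0 < r - dist c z" using dist by simp
    fix x assume "x \<in> edom f" "dist z x < r - dist c z"
    then have "x \<in> cball c r \<inter> edom f" using dist_triangle[of c x z] by auto
    then show "\<phi> z + \<alpha> * dist z z \<le> \<phi> x + \<alpha> * dist z x" using min by simp
  qed (use z in simp)
  moreover have "f z \<le> f c"
  proof -
    have "0 \<le> \<alpha> * dist c z" using pos(2) by simp
    then have "\<phi> z \<le> \<phi> c" using descent by linarith
    then show ?thesis using z by (simp add: f_\<phi> c)
  qed
  ultimately show ?thesis using z dist by (auto simp: \<phi>_def)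
qed

section \<open>The fuzzy sum rule\<close>

text \<open>Families indexed by \<open>'i\<close> are bounded functions on a discrete copy of \<open>'i\<close>, which form a Banach space
  under the supremum norm.\<close>

definition coord :: "'i \<Rightarrow> ('i discrete \<Rightarrow>\<^sub>C 'a::real_normed_vector) \<Rightarrow> 'a" where
  "coord i x = apply_bcontfun x (discrete i)"

definition single :: "'i \<Rightarrow> 'a::real_normed_vector \<Rightarrow> 'i discrete \<Rightarrow>\<^sub>C 'a" where
  "single i h = Bcontfun (\<lambda>j. if j = discrete i then h else 0)"

lemma coord_eqI: "(\<And>i. coord i x = coord i y) \<Longrightarrow> x = y"
  unfolding coord_def by (metis bcontfun_eqI discrete_cases)

lemma norm_coord_le: "norm (coord i x) \<le> norm x"
  unfolding coord_def by (rule norm_bounded)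

lemma norm_le_coord: "(\<And>i. norm (coord i x) \<le> b) \<Longrightarrow> norm x \<le> b"
  unfolding coord_def by (metis norm_bound discrete_cases)

lemma bounded_linear_coord: "bounded_linear (coord i)"
  by (rule bounded_linear_intro[where K = 1]) (simp_all add: coord_def norm_bounded)

lemma coord_const: "coord i (const_bcontfun a) = a"
  by (simp add: coord_def)

lemma coord_single: "coord j (single i h) = (if j = i then h else 0)"
proof -
  have "(\<lambda>j. if j = discrete i then h else 0) \<in> bcontfun"
    by (auto simp: bcontfun_def continuous_on_open_vimage open_discrete
        intro!: boundedI[of _ "norm h"])
  then show ?thesis by (simp add: coord_def single_def Bcontfun_inverse discrete_inject)
qed

lemmas linear_coord = bounded_linear.linear[OF bounded_linear_coord]
  and isCont_coord = linear_continuous_at[OF bounded_linear_coord]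

lemmas coord_add = linear_add[OF linear_coord]
  and coord_diff = linear_diff[OF linear_coord]
  and coord_scaleR = linear_scale[OF linear_coord]
  and coord_sum = linear_sum[OF linear_coord]

lemma bounded_linear_single: "bounded_linear (single i)"
proof (rule bounded_linear_intro[where K = 1])
  show "norm (single i h) \<le> norm h * 1" for h :: 'a
    by (rule norm_le_coord) (simp add: coord_single)
qed (auto intro!: coord_eqI simp: coord_add coord_scaleR coord_single)

lemma Blinfun_single: "blinfun_apply (Blinfun (single i)) = single i"
  by (rule bounded_linear_Blinfun_apply[OF bounded_linear_single])

lemma coord_sum_single:
  assumes "finite I"
  shows "coord j (\<Sum>i\<in>I. single i h) = (if j \<in> I then h else 0)"
  using assms by (simp add: coord_sum coord_single)

definition spread :: "'i set \<Rightarrow> ('i discrete \<Rightarrow>\<^sub>C 'a::real_normed_vector) \<Rightarrow> real" where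
  "spread I x = (\<Sum>i\<in>I. \<Sum>j\<in>I. norm (coord i x - coord j x))"

lemma spread_nonneg: "0 \<le> spread I x"
  unfolding spread_def by (intro sum_nonneg) auto

lemma dist_coord_le_spread:
  assumes "finite I" "i \<in> I" "j \<in> I"
  shows "dist (coord i x) (coord j x) \<le> spread I x"
proof -
  have "dist (coord i x) (coord j x) \<le> (\<Sum>j\<in>I. norm (coord i x - coord j x))"
    unfolding dist_norm using assms by (intro member_le_sum) auto
  also have "\<dots> \<le> spread I x"
    unfolding spread_def using assms by (intro member_le_sum) (auto intro: sum_nonneg)
  finally show ?thesis .
qed

lemma spread_const: "spread I (const_bcontfun a) = 0"
  by (simp add: spread_def coord_const)

lemma spread_add_diagonal:
  assumes "finite I"
  shows "spread I (x + (\<Sum>i\<in>I. single i h)) = spread I x"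
  unfolding spread_def using assms by (intro sum.cong) (auto simp: coord_add coord_sum_single)

lemma convex_on_spread: "convex_on UNIV (spread I)"
proof -
  have "convex_on UNIV (\<lambda>x. norm (coord i x - coord j x))" for i j
  proof -
    have "linear (\<lambda>x. coord i x - coord j x)"
      by (intro linear_compose_sub linear_coord)
    then show ?thesis
      using convex_on_compose_linear[OF _ convex_on_dist[OF convex_UNIV, of 0]]
      by (fastforce simp: dist_norm)
  qed
  then show ?thesis unfolding spread_def[abs_def] by (intro convex_on_sum_functions) auto
qed

lemma isCont_spread: "isCont (spread I) x"
proof -
  have "isCont (\<lambda>x. norm (coord i x - coord j x)) x" for i j
    by (intro isCont_norm isCont_diff isCont_coord)
  then show ?thesis unfolding spread_def[abs_def] isCont_def by (intro tendsto_sum)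
qed

lemma proper_convex_sum_coord:
  assumes "finite I" and "\<And>i. i \<in> I \<Longrightarrow> proper_convex (f i)" and "\<And>i. i \<in> I \<Longrightarrow> coord i z \<in> edom (f i)"
  shows "proper_convex (\<lambda>x. \<Sum>i\<in>I. f i (coord i x))"
proof (rule proper_convex_sum[OF assms(1)])
  fix i assume i: "i \<in> I"
  show "proper_convex (\<lambda>x. f i (coord i x))"
    by (rule proper_convex_compose_linear[OF assms(2)[OF i] linear_coord assms(3)[OF i]])
  show "z \<in> edom (\<lambda>x. f i (coord i x))" using assms(3)[OF i] by (simp add: edom_def)
qed

lemma edom_sum_coord:
  assumes "finite I"
  shows "x \<in> edom (\<lambda>x. \<Sum>i\<in>I. f i (coord i x)) \<longleftrightarrow> (\<forall>i\<in>I. coord i x \<in> edom (f i))"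
  unfolding edom_sum[OF assms] by (simp add: edom_def)

lemma fsubdiff_sum_coord:
  assumes I: "finite I" and f: "\<And>i. i \<in> I \<Longrightarrow> proper_convex (f i)"
    and z: "\<And>i. i \<in> I \<Longrightarrow> coord i z \<in> edom (f i)"
    and Y: "Y \<in> fsubdiff (\<lambda>x. \<Sum>i\<in>I. f i (coord i x)) z" and i: "i \<in> I"
  shows "Y o\<^sub>L Blinfun (single i) \<in> fsubdiff (f i) (coord i z)"
proof -
  let ?F = "\<lambda>x. \<Sum>i\<in>I. f i (coord i x)" and ?r = "\<lambda>i x. real_of_ereal (f i x)"
  have real_sum: "real_of_ereal (?F x) = (\<Sum>i\<in>I. ?r i (coord i x))"
    if "\<And>i. i \<in> I \<Longrightarrow> coord i x \<in> edom (f i)" for x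
  proof -
    have "?F x = (\<Sum>i\<in>I. ereal (?r i (coord i x)))"
      using proper_convex_real[OF f] that by (intro sum.cong) auto
    then show ?thesis by simp
  qed
  have pcF: "proper_convex ?F" using f z by (rule proper_convex_sum_coord[OF I])
  have zF: "z \<in> edom ?F" using z by (simp only: edom_sum_coord[OF I]) blast
  have "?r i (coord i z) + Y (single i (w - coord i z)) \<le> ?r i w" if w: "w \<in> edom (f i)" for w
  proof -
    let ?x = "z + single i (w - coord i z)"
    have coord_x: "coord j ?x = (if j = i then w else coord j z)" for j
      by (simp add: coord_add coord_single)
    then have dom: "coord j ?x \<in> edom (f j)" if "j \<in> I" for j using z that w by simp
    have "?x \<in> edom ?F" using dom by (simp only: edom_sum_coord[OF I]) blast
    then have "real_of_ereal (?F z) + Y (?x - z) \<le> real_of_ereal (?F ?x)"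
      using Y fsubdiff_edom_iff[OF pcF zF] by blast
    moreover have "(\<Sum>j\<in>I - {i}. ?r j (coord j ?x)) = (\<Sum>j\<in>I - {i}. ?r j (coord j z))"
      by (intro sum.cong) (auto simp: coord_x)
    ultimately show ?thesis
      using real_sum[OF dom] real_sum[OF z] by (simp add: sum.remove[OF I i] coord_x)
  qed
  then show ?thesis
    by (simp add: fsubdiff_edom_iff[OF f[OF i] z[OF i]] Blinfun_single)
qed

lemma spread_penalty_exists:
  assumes I: "finite I" and \<delta>: "0 < \<delta>" and lower: "\<And>x. x \<in> S \<Longrightarrow> ereal b \<le> F x"
    and near: "\<And>x. x \<in> S \<Longrightarrow> (\<forall>i\<in>I. \<forall>j\<in>I. dist (coord i x) (coord j x) < \<delta>) \<Longrightarrow> ereal v \<le> F x"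
  shows "\<exists>\<gamma>\<ge>0. \<forall>x\<in>S. ereal v \<le> F x + ereal (\<gamma> * spread I x)"
proof (intro exI conjI ballI)
  define \<gamma> where "\<gamma> = max 0 (v - b) / \<delta>"
  show "0 \<le> \<gamma>" using \<delta> by (simp add: \<gamma>_def)
  fix x assume x: "x \<in> S"
  show "ereal v \<le> F x + ereal (\<gamma> * spread I x)"
  proof (cases "\<forall>i\<in>I. \<forall>j\<in>I. dist (coord i x) (coord j x) < \<delta>")
    case True
    have "ereal v + 0 \<le> F x + ereal (\<gamma> * spread I x)"
      using near[OF x True] spread_nonneg[of I x] \<open>0 \<le> \<gamma>\<close> by (intro add_mono) auto
    then show ?thesis by simp
  next
    case False
    then obtain i j where "i \<in> I" "j \<in> I" "\<delta> \<le> dist (coord i x) (coord j x)"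
      by (auto simp: not_less)
    then have "\<delta> \<le> spread I x" using dist_coord_le_spread[OF I, of i j x] by simp
    then have "\<gamma> * \<delta> \<le> \<gamma> * spread I x" using \<open>0 \<le> \<gamma>\<close> by (rule mult_left_mono)
    then have "v - b \<le> \<gamma> * spread I x" using \<delta> by (simp add: \<gamma>_def)
    then have "ereal b + ereal (v - b) \<le> F x + ereal (\<gamma> * spread I x)"
      by (intro add_mono lower[OF x]) simp
    then show ?thesis by simp
  qed
qed

lemma lsc_at_sum_coord:
  assumes "finite I" and "\<And>i. i \<in> I \<Longrightarrow> lsc_at (coord i x) (f i)"
    and "\<And>i. i \<in> I \<Longrightarrow> proper_convex (f i)"
  shows "lsc_at x (\<lambda>x. \<Sum>i\<in>I. f i (coord i x))"
proof (rule lsc_at_sum[OF assms(1)])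
  fix i assume i: "i \<in> I"
  show "lsc_at x (\<lambda>x. f i (coord i x))"
    using assms(2)[OF i] isCont_coord by (rule lsc_at_compose)
  show "f i (coord i x) \<noteq> -\<infinity>" by (rule proper_convex_not_MInfty[OF assms(3)[OF i]])
qed

lemma spread_penalised_min:
  fixes F :: "('i discrete \<Rightarrow>\<^sub>C 'a::banach) \<Rightarrow> ereal"
  assumes I: "finite I" and F: "proper_convex F" and c: "c \<in> edom F" "spread I c = 0"
    and lsc: "\<And>x. x \<in> cball c r \<Longrightarrow> lsc_at x F"
    and pos: "0 < r" "0 < \<alpha>" "0 < \<delta>" "\<eta> < \<alpha> * r"
    and almost_min: "\<And>x. x \<in> cball c r \<Longrightarrow> (\<forall>i\<in>I. \<forall>j\<in>I. dist (coord i x) (coord j x) < \<delta>) \<Longrightarrow>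
      F c \<le> F x + ereal \<eta>"
  shows "\<exists>\<gamma>\<ge>0. \<exists>z\<in>ball c r \<inter> edom F. F z \<le> F c \<and>
    (\<forall>x\<in>edom F. real_of_ereal (F z) + \<gamma> * spread I z
      \<le> real_of_ereal (F x) + \<gamma> * spread I x + \<alpha> * dist z x)"
proof -
  obtain v where v: "F c = ereal v" using proper_convex_real[OF F c(1)] by metis
  obtain b where b: "\<And>x. x \<in> cball c r \<Longrightarrow> ereal b \<le> F x"
    using proper_convex_bounded_below[OF F c(1) lsc, of r] pos(1) by fastforce
  have near: "ereal (v - \<eta>) \<le> F x"
    if "x \<in> cball c r" "\<forall>i\<in>I. \<forall>j\<in>I. dist (coord i x) (coord j x) < \<delta>" for x
    using almost_min[OF that] by (cases "F x") (auto simp: v)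
  have "\<exists>\<gamma>\<ge>0. \<forall>x\<in>cball c r. ereal (v - \<eta>) \<le> F x + ereal (\<gamma> * spread I x)"
    by (rule spread_penalty_exists[OF I pos(3) b near])
  then obtain \<gamma> where \<gamma>: "0 \<le> \<gamma>"
    "\<And>x. x \<in> cball c r \<Longrightarrow> ereal (v - \<eta>) \<le> F x + ereal (\<gamma> * spread I x)" by blast
  define P where "P x = F x + ereal (\<gamma> * spread I x)" for x
  have edomP: "edom P = edom F" by (auto simp: edom_def P_def)
  have P_c: "P c = F c" by (simp add: P_def c(2))
  have "\<exists>z\<in>ball c r \<inter> edom P. P z \<le> P c \<and>
      (\<forall>x\<in>edom P. real_of_ereal (P z) \<le> real_of_ereal (P x) + \<alpha> * dist z x)"
  proof (rule ekeland_proper_convex[OF _ _ _ pos(1,2,4)])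
    show "proper_convex P" unfolding P_def
      using F proper_convex_ereal[OF convex_on_cmul[OF \<gamma>(1) convex_on_spread]] c(1)
      by (rule proper_convex_add) (simp add: edom_def)
    show "lsc_at x P" if "x \<in> cball c r" for x unfolding P_def
      by (intro lsc_at_add lsc[OF that] lsc_at_continuous isCont_mult isCont_spread
          continuous_const proper_convex_not_MInfty[OF F]) simp
    show "P c \<le> P x + ereal \<eta>" if "x \<in> cball c r" for x
      unfolding P_c using \<gamma>(2)[OF that] by (cases "F x") (auto simp: P_def v)
  qed (simp add: edomP c(1))
  then obtain z where z: "z \<in> ball c r" "z \<in> edom F" "P z \<le> F c"
    and min: "\<And>x. x \<in> edom F \<Longrightarrow> real_of_ereal (P z) \<le> real_of_ereal (P x) + \<alpha> * dist z x"
    unfolding edomP P_c by blast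
  have "F z + 0 \<le> P z" unfolding P_def using \<gamma>(1) spread_nonneg[of I z] by (intro add_left_mono) simp
  then have "F z \<le> F c" using z(3) by simp
  have "real_of_ereal (P x) = real_of_ereal (F x) + \<gamma> * spread I x" if "x \<in> edom F" for x
    using proper_convex_real[OF F that] by (metis P_def plus_ereal.simps(1) real_of_ereal.simps(1))
  then have "real_of_ereal (F z) + \<gamma> * spread I z
      \<le> real_of_ereal (F x) + \<gamma> * spread I x + \<alpha> * dist z x" if "x \<in> edom F" for x
    using min[OF that] that z(2) by simp
  then show ?thesis using \<gamma>(1) z(1,2) \<open>F z \<le> F c\<close> by blast
qed

lemma norm_sum_fsubdiff_le:
  assumes I: "finite I" and \<alpha>: "0 \<le> \<alpha>"
    and Y: "\<And>h. \<gamma> * spread I z - blinfun_apply Y h \<le> \<gamma> * spread I (z + h) + \<alpha> * norm h"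
  shows "norm (\<Sum>i\<in>I. Y o\<^sub>L Blinfun (single i)) \<le> \<alpha>"
proof (rule norm_blinfun_bound[OF \<alpha>])
  fix h
  let ?D = "\<lambda>h. \<Sum>i\<in>I. single i h" and ?y = "\<Sum>i\<in>I. Y o\<^sub>L Blinfun (single i)"
  have Y_D: "?y h = Y (?D h)" for h
    by (simp add: blinfun.sum_left blinfun.sum_right Blinfun_single)
  have lower: "- (\<alpha> * norm h) \<le> ?y h" for h
  proof -
    have "norm (?D h) \<le> norm h" by (rule norm_le_coord) (simp add: coord_sum_single[OF I])
    then have "\<alpha> * norm (?D h) \<le> \<alpha> * norm h" using \<alpha> by (rule mult_left_mono)
    then show ?thesis using Y[of "?D h"] by (simp add: Y_D spread_add_diagonal[OF I])
  qed
  show "norm (?y h) \<le> \<alpha> * norm h"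
    using lower[of h] lower[of "- h"] by (simp add: blinfun.minus_right abs_le_iff)
qed

lemma almost_stationary_near_almost_min:
  fixes F :: "('i discrete \<Rightarrow>\<^sub>C 'a::banach) \<Rightarrow> ereal"
  assumes I: "finite I" and F: "proper_convex F" and c: "c \<in> edom F" "spread I c = 0"
    and lsc: "\<And>x. x \<in> cball c r \<Longrightarrow> lsc_at x F"
    and pos: "0 < r" "0 < \<alpha>" "0 < \<delta>" "\<eta> < \<alpha> * r"
    and almost_min: "\<And>x. x \<in> cball c r \<Longrightarrow> (\<forall>i\<in>I. \<forall>j\<in>I. dist (coord i x) (coord j x) < \<delta>) \<Longrightarrow>
      F c \<le> F x + ereal \<eta>"
  shows "\<exists>z\<in>ball c r \<inter> edom F. F z \<le> F c \<and>
    (\<exists>Y\<in>fsubdiff F z. norm (\<Sum>i\<in>I. Y o\<^sub>L Blinfun (single i)) \<le> \<alpha>)"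
proof -
  obtain \<gamma> z where \<gamma>: "0 \<le> \<gamma>" and z: "z \<in> ball c r \<inter> edom F" "F z \<le> F c"
    and min: "\<And>x. x \<in> edom F \<Longrightarrow> real_of_ereal (F z) + \<gamma> * spread I z
      \<le> real_of_ereal (F x) + \<gamma> * spread I x + \<alpha> * dist z x"
    using spread_penalised_min[OF I F c lsc pos almost_min] by metis
  define H where "H x = \<gamma> * spread I x + \<alpha> * dist z x" for x
  have "\<exists>Y\<in>fsubdiff F z. \<forall>h. H z - blinfun_apply Y h \<le> H (z + h)"
  proof (rule fsubdiff_sum_rule[OF F])
    show "convex_on UNIV H" unfolding H_def
      using \<gamma> pos(2) by (intro convex_on_add convex_on_cmul convex_on_spread convex_on_dist) auto
    show "isCont H z" unfolding H_def
      by (intro isCont_add isCont_mult isCont_spread continuous_const continuous_dist continuous_ident)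
    show "real_of_ereal (F z) + H z \<le> real_of_ereal (F x) + H x" if "x \<in> edom F" for x
      using min[OF that] by (simp add: H_def)
  qed (use z(1) in blast)
  then obtain Y where Y: "Y \<in> fsubdiff F z" "\<And>h. H z - Y h \<le> H (z + h)" by blast
  have "norm (\<Sum>i\<in>I. Y o\<^sub>L Blinfun (single i)) \<le> \<alpha>"
    using pos(2) Y(2) by (intro norm_sum_fsubdiff_le[OF I]) (simp_all add: H_def dist_norm)
  then show ?thesis using z Y(1) by blast
qed

theorem fuzzy_sum_rule:
  fixes f :: "'i \<Rightarrow> 'a::banach \<Rightarrow> ereal"
  assumes I: "finite I" and f: "\<And>i. i \<in> I \<Longrightarrow> proper_convex (f i)"
    and c: "\<And>i. i \<in> I \<Longrightarrow> c \<in> edom (f i)"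
    and lsc: "\<And>i x. i \<in> I \<Longrightarrow> x \<in> cball c r \<Longrightarrow> lsc_at x (f i)"
    and pos: "0 < r" "0 < \<alpha>" "0 < \<delta>" "\<eta> < \<alpha> * r"
    and almost_min: "\<And>x. (\<forall>i\<in>I. x i \<in> cball c r) \<Longrightarrow> (\<forall>i\<in>I. \<forall>j\<in>I. dist (x i) (x j) < \<delta>) \<Longrightarrow>
      (\<Sum>i\<in>I. f i c) \<le> (\<Sum>i\<in>I. f i (x i)) + ereal \<eta>"
  shows "\<exists>x y. (\<forall>i\<in>I. x i \<in> ball c r \<and> x i \<in> edom (f i) \<and> y i \<in> fsubdiff (f i) (x i)) \<and>
    (\<Sum>i\<in>I. f i (x i)) \<le> (\<Sum>i\<in>I. f i c) \<and> norm (\<Sum>i\<in>I. y i) \<le> \<alpha>"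
proof -
  let ?c = "const_bcontfun c :: 'i discrete \<Rightarrow>\<^sub>C 'a"
  define F where "F x = (\<Sum>i\<in>I. f i (coord i x))" for x
  have F_c: "F ?c = (\<Sum>i\<in>I. f i c)" by (simp add: F_def coord_const)
  have dist_coord_le: "dist c (coord i x) \<le> dist ?c x" for i x
    using norm_coord_le[of i "?c - x"] by (simp add: coord_diff coord_const dist_norm)
  then have coord_cball: "coord i x \<in> cball c r" if "x \<in> cball ?c r" for i x
    using that order_trans[OF dist_coord_le] by simp
  have "\<exists>z\<in>ball ?c r \<inter> edom F. F z \<le> F ?c \<and>
    (\<exists>Y\<in>fsubdiff F z. norm (\<Sum>i\<in>I. Y o\<^sub>L Blinfun (single i)) \<le> \<alpha>)"
  proof (rule almost_stationary_near_almost_min[OF I _ _ _ _ pos])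
    show "proper_convex F" unfolding F_def
      by (rule proper_convex_sum_coord[where z = ?c]) (simp_all add: coord_const I f c)
    show "?c \<in> edom F" unfolding F_def edom_sum_coord[OF I] by (simp add: coord_const c)
    show "lsc_at x F" if "x \<in> cball ?c r" for x
      unfolding F_def using coord_cball[OF that] by (intro lsc_at_sum_coord I f lsc)
    show "F ?c \<le> F x + ereal \<eta>"
      if "x \<in> cball ?c r" "\<forall>i\<in>I. \<forall>j\<in>I. dist (coord i x) (coord j x) < \<delta>" for x
      using almost_min[of "\<lambda>i. coord i x"] coord_cball that unfolding F_c by (simp add: F_def)
  qed (rule spread_const)
  then obtain z Y where z: "z \<in> ball ?c r" "z \<in> edom F" "F z \<le> F ?c" and Y: "Y \<in> fsubdiff F z"
    and norm_Y: "norm (\<Sum>i\<in>I. Y o\<^sub>L Blinfun (single i)) \<le> \<alpha>" by blast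
  have edom: "coord i z \<in> edom (f i)" if "i \<in> I" for i
    using z(2) that unfolding F_def edom_sum_coord[OF I] by blast
  have ball: "coord i z \<in> ball c r" for i
    using dist_coord_le[of i z] z(1) by simp
  have subgradient: "Y o\<^sub>L Blinfun (single i) \<in> fsubdiff (f i) (coord i z)" if "i \<in> I" for i
    by (rule fsubdiff_sum_coord[OF I f edom _ that]) (use Y in \<open>simp_all add: F_def[abs_def]\<close>)
  have sum_le: "(\<Sum>i\<in>I. f i (coord i z)) \<le> (\<Sum>i\<in>I. f i c)"
    using z(3) unfolding F_c by (simp add: F_def)
  show ?thesis
    by (intro exI[of _ "\<lambda>i. coord i z"] exI[of _ "\<lambda>i. Y o\<^sub>L Blinfun (single i)"]
        conjI ballI ball edom subgradient sum_le norm_Y)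
qed

section \<open>Strong duality\<close>

definition lagr_head :: "(nat \<Rightarrow> 'a \<Rightarrow> ereal) \<Rightarrow> nat \<Rightarrow> (nat \<Rightarrow> real) \<Rightarrow> 'a \<Rightarrow> ereal" where
  "lagr_head f m l x = f 0 x + (\<Sum>k\<in>{1..m}. emul (l k) (f k x))"

definition lagr_tail :: "(nat \<Rightarrow> 'a \<Rightarrow> ereal) \<Rightarrow> nat \<Rightarrow> (nat \<Rightarrow> real) \<Rightarrow> 'a \<Rightarrow> nat \<Rightarrow> ereal" where
  "lagr_tail f m l x k = (if m < k then emul (l k) (epos (f k x)) else 0)"

lemma lagr_eq: "lagr f m l x = lagr_head f m l x + (\<Sum>k. lagr_tail f m l x k)"
  by (simp add: lagr_def lagr_head_def lagr_tail_def)

lemma lagr_head_not_MInfty: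
  assumes "\<And>k. f k x \<noteq> -\<infinity>"
  shows "lagr_head f m l x \<noteq> -\<infinity>"
  using assms sum_ereal_not_MInfty[of "{1..m}" "\<lambda>k. emul (l k) (f k x)"]
  by (simp add: lagr_head_def emul_not_MInfty)

lemma lagr_head_real:
  assumes "\<And>k. k \<le> m \<Longrightarrow> f k x = ereal (a k)"
  shows "lagr_head f m l x = ereal (a 0 + (\<Sum>k\<in>{1..m}. l k * a k))"
proof -
  have "(\<Sum>k\<in>{1..m}. emul (l k) (f k x)) = (\<Sum>k\<in>{1..m}. ereal (l k * a k))"
    using assms by (intro sum.cong) auto
  then show ?thesis using assms[of 0] by (simp add: lagr_head_def)
qed

lemma lagr_tail_nonneg: "linf_plus l \<Longrightarrow> 0 \<le> lagr_tail f m l x k"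
  using epos_nonneg[of "f k x"] by (simp add: lagr_tail_def linf_plus_def emul_def)

lemma suminf_lagr_tail_nonneg: "linf_plus l \<Longrightarrow> 0 \<le> (\<Sum>k. lagr_tail f m l x k)"
  by (intro suminf_0_le lagr_tail_nonneg)

lemma lagr_tail_le_suminf: "linf_plus l \<Longrightarrow> lagr_tail f m l x k \<le> (\<Sum>k. lagr_tail f m l x k)"
  using sum_le_suminf[of "lagr_tail f m l x" "{k}"] summable_ereal_pos[of "lagr_tail f m l x"]
  by (simp add: lagr_tail_nonneg)

lemma lagr_finite_imp_edom:
  assumes l: "linf_plus l" and not_MInfty: "\<And>k. f k x \<noteq> -\<infinity>" and finite: "lagr f m l x \<noteq> \<infinity>"
  shows "x \<in> edom (f k)"
proof -
  have head: "lagr_head f m l x \<noteq> \<infinity>" and tail: "(\<Sum>k. lagr_tail f m l x k) \<noteq> \<infinity>"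
    using finite lagr_head_not_MInfty[of f x m l] not_MInfty suminf_lagr_tail_nonneg[OF l, of f m x]
    unfolding lagr_eq by auto
  consider "k = 0" | "k \<in> {1..m}" | "m < k" by force
  then have "f k x \<noteq> \<infinity>"
  proof cases
    case 1
    then show ?thesis using head by (auto simp: lagr_head_def)
  next
    case 2
    have "(\<Sum>k\<in>{1..m}. emul (l k) (f k x)) \<noteq> \<infinity>" using head by (auto simp: lagr_head_def)
    then have "emul (l k) (f k x) \<noteq> \<infinity>" using 2 by (simp add: sum_Pinfty)
    then show ?thesis by auto
  next
    case 3
    then show ?thesis using lagr_tail_le_suminf[OF l, of f m x k] tail by (auto simp: lagr_tail_def)
  qed
  then show ?thesis by (simp add: edom_def less_top)
qed

text \<open>The infinitely many constraints with index above m share the multiplier c of their supremum.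
  It is raised to \<open>c + 1\<close> so that a finite sum bounds the supremum even if \<open>c = 0\<close>.\<close>

lemma SUP_le_suminf_lagr_tail:
  assumes l: "linf_plus l" and l_tail: "\<And>k. m < k \<Longrightarrow> l k = c + 1" and c: "0 \<le> c"
    and real: "\<And>k. m < k \<Longrightarrow> f k x = ereal (a k)" and R: "(\<Sum>k. lagr_tail f m l x k) = ereal R"
  shows "bdd_above (a ` {m<..})" and "c * (SUP k\<in>{m<..}. a k) \<le> R"
proof -
  have bound: "(c + 1) * max (a k) 0 \<le> R" if "m < k" for k
  proof -
    have "lagr_tail f m l x k = ereal ((c + 1) * max (a k) 0)"
      using that by (simp add: lagr_tail_def l_tail real del: ereal_max)
    then show ?thesis using lagr_tail_le_suminf[OF l, of f m x k] by (simp add: R)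
  qed
  have "a k \<le> R" if "m < k" for k
  proof -
    have "a k \<le> 1 * max (a k) 0" by simp
    also have "\<dots> \<le> (c + 1) * max (a k) 0" using c by (intro mult_right_mono) auto
    finally show ?thesis using bound[OF that] by simp
  qed
  then show "bdd_above (a ` {m<..})" by (intro bdd_aboveI2) auto
  have "c * a k \<le> R" if "m < k" for k
  proof -
    have "c * a k \<le> c * max (a k) 0" using c by (intro mult_left_mono) auto
    also have "\<dots> \<le> (c + 1) * max (a k) 0" by (intro mult_right_mono) auto
    finally have "c * a k \<le> (c + 1) * max (a k) 0" .
    then show ?thesis using bound[OF that] by simp
  qed
  then show "c * (SUP k\<in>{m<..}. a k) \<le> R"
  proof (cases "c = 0")
    case True
    then show ?thesis using suminf_lagr_tail_nonneg[OF l, of f m x] by (simp add: R)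
  next
    case False
    have "(SUP k\<in>{m<..}. a k) \<le> R / c"
      using \<open>\<And>k. m < k \<Longrightarrow> c * a k \<le> R\<close> False c
      by (intro cSUP_least) (auto simp: pos_le_divide_eq mult.commute)
    then show ?thesis using False c by (simp add: pos_le_divide_eq mult.commute)
  qed
qed

lemma ereal_SUP_less_0_imp_uniform:
  fixes a :: "'i \<Rightarrow> ereal"
  assumes "(SUP i\<in>I. a i) < 0"
  shows "\<exists>s<0. \<forall>i\<in>I. a i \<le> ereal s"
proof -
  obtain s where s: "(SUP i\<in>I. a i) < ereal s" "s < 0"
    using ereal_dense2[OF assms] by (auto simp: zero_ereal_def)
  then have "a i \<le> ereal s" if "i \<in> I" for i
    using that by (metis SUP_upper less_imp_le order_trans)
  then show ?thesis using s(2) by blast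
qed

lemma convex_on_bdd_above_edom:
  assumes f: "\<And>k. proper_convex (f k)"
  shows "convex_on {x \<in> (\<Inter>k. edom (f k)). bdd_above ((\<lambda>k. real_of_ereal (f k x)) ` I)}
    (\<lambda>x. real_of_ereal (f j x))"
proof -
  have edom: "convex (\<Inter>k. edom (f k))"
    using convex_on_imp_convex[OF proper_convex_imp_convex_on[OF f]] by (intro convex_INT) auto
  then have "convex_on (\<Inter>k. edom (f k)) (\<lambda>x. real_of_ereal (f k x))" for k
    using convex_on_subset[OF proper_convex_imp_convex_on[OF f]] by (metis INT_lower UNIV_I)
  then have "convex {x \<in> (\<Inter>k. edom (f k)). bdd_above ((\<lambda>k. real_of_ereal (f k x)) ` I)}"
    by (rule convex_Collect_bdd_above[OF edom])
  then show ?thesis by (rule convex_on_subset[OF proper_convex_imp_convex_on[OF f], rotated]) blast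
qed

lemma slater_multipliers:
  fixes f :: "nat \<Rightarrow> 'a::real_vector \<Rightarrow> ereal"
  assumes proper: "\<And>k. proper_convex (f k)"
    and slater: "y \<in> edom (f 0)" "(SUP k\<in>{1..}. f k y) < 0"
    and opt: "\<forall>x\<in>edom (f 0). (\<forall>k\<ge>1. f k x \<le> 0) \<longrightarrow> ereal v \<le> f 0 x"
  shows "\<exists>\<mu> c. (\<forall>k. 0 \<le> \<mu> k) \<and> 0 \<le> c \<and>
    (\<forall>x. (\<forall>k. x \<in> edom (f k)) \<longrightarrow> bdd_above ((\<lambda>k. real_of_ereal (f k x)) ` {m<..}) \<longrightarrow>
      v \<le> real_of_ereal (f 0 x) + (\<Sum>k\<in>{1..m}. \<mu> k * real_of_ereal (f k x))
        + c * (SUP k\<in>{m<..}. real_of_ereal (f k x)))"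
proof -
  let ?r = "\<lambda>k x. real_of_ereal (f k x)"
  define D where "D = {x \<in> (\<Inter>k. edom (f k)). bdd_above ((\<lambda>k. ?r k x) ` {m<..})}"
  have conv: "convex_on D (?r k)" for k unfolding D_def by (rule convex_on_bdd_above_edom[OF proper])
  have real: "ereal (?r k x) = f k x" if "x \<in> D" for k x
    using that by (intro proper_convex_real[OF proper]) (auto simp: D_def)
  obtain s where s: "s < 0" and y_le: "\<And>k. 1 \<le> k \<Longrightarrow> f k y \<le> ereal s"
    using ereal_SUP_less_0_imp_uniform[of "\<lambda>k. f k y" "{1..}"] slater(2) by auto
  have y_edom: "y \<in> edom (f k)" for k
    using slater(1) y_le[of k] by (cases "k = 0") (auto simp: edom_def)
  have r_le: "?r k y \<le> s" if "1 \<le> k" for k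
    using y_le[OF that] proper_convex_real[OF proper y_edom, of k] by (metis ereal_less_eq(3))
  have constraints: "{1..m} \<union> {m<..} = {1..}" by auto
  have "\<exists>\<mu> c. (\<forall>k. 0 \<le> \<mu> k) \<and> 0 \<le> c \<and>
    (\<forall>x\<in>D. v \<le> ?r 0 x + (\<Sum>k\<in>{1..m}. \<mu> k * ?r k x) + c * (SUP k\<in>{m<..}. ?r k x))"
  proof (rule convex_multipliers_with_sup[where s = s and y = y], unfold constraints)
    have "bdd_above ((\<lambda>k. ?r k y) ` {m<..})" using r_le by (intro bdd_aboveI2[of _ _ s]) simp
    then show "y \<in> D" using y_edom by (simp add: D_def)
    fix x assume x: "x \<in> D" "\<forall>k\<in>{1..}. ?r k x \<le> 0"
    have "ereal (?r k x) \<le> 0" if "1 \<le> k" for k using x(2) that by simp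
    then have "f k x \<le> 0" if "1 \<le> k" for k using that unfolding real[OF x(1)] .
    moreover have "x \<in> edom (f 0)" using x(1) by (simp add: D_def)
    ultimately have "ereal v \<le> f 0 x" using opt by blast
    then show "v \<le> ?r 0 x" using real[OF x(1), of 0] by (metis ereal_less_eq(3))
  qed (use conv r_le s in \<open>auto simp: D_def\<close>)
  then show ?thesis by (simp add: D_def imp_conjL)
qed

lemma linf_plus_if:
  assumes "\<And>k. 0 \<le> \<mu> k" "0 \<le> c"
  shows "linf_plus (\<lambda>k. if k \<le> m then \<mu> k else c)"
proof -
  have "range (\<lambda>k. if k \<le> m then \<mu> k else c) \<subseteq> insert c (\<mu> ` {..m})" by auto
  then have "bounded (range (\<lambda>k. if k \<le> m then \<mu> k else c))"
    by (rule bounded_subset[rotated]) (simp add: finite_imp_bounded)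
  then show ?thesis using assms by (simp add: linf_plus_def)
qed

theorem slater_strong_duality:
  fixes f :: "nat \<Rightarrow> 'a::real_vector \<Rightarrow> ereal"
  assumes proper: "\<And>k. proper_convex (f k)"
    and slater: "y \<in> edom (f 0)" "(SUP k\<in>{1..}. f k y) < 0"
    and opt: "\<forall>x\<in>edom (f 0). (\<forall>k\<ge>1. f k x \<le> 0) \<longrightarrow> ereal v \<le> f 0 x"
  shows "\<exists>l. linf_plus l \<and> (\<forall>x. ereal v \<le> lagr f m l x)"
proof -
  let ?r = "\<lambda>k x. real_of_ereal (f k x)"
  obtain \<mu> c where \<mu>: "\<forall>k. 0 \<le> \<mu> k" and c: "0 \<le> c"
    and bound: "\<forall>x. (\<forall>k. x \<in> edom (f k)) \<longrightarrow> bdd_above ((\<lambda>k. ?r k x) ` {m<..}) \<longrightarrow>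
      v \<le> ?r 0 x + (\<Sum>k\<in>{1..m}. \<mu> k * ?r k x) + c * (SUP k\<in>{m<..}. ?r k x)"
    using slater_multipliers[OF proper slater opt, of m] by (elim exE conjE)
  define l where "l k = (if k \<le> m then \<mu> k else c + 1)" for k
  have l: "linf_plus l" unfolding l_def[abs_def] using \<mu> c by (intro linf_plus_if) auto
  have "ereal v \<le> lagr f m l x" for x
  proof (cases "lagr f m l x = \<infinity>")
    case False
    have edom: "x \<in> edom (f k)" for k
      using lagr_finite_imp_edom[OF l proper_convex_not_MInfty[OF proper] False] .
    then have real: "f k x = ereal (?r k x)" for k using proper_convex_real[OF proper] by metis
    have "(\<Sum>k. lagr_tail f m l x k) \<noteq> \<infinity>"
      using False lagr_head_not_MInfty[of f x m l] proper_convex_not_MInfty[OF proper]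
      by (auto simp: lagr_eq)
    then obtain R where R: "(\<Sum>k. lagr_tail f m l x k) = ereal R"
      using suminf_lagr_tail_nonneg[OF l, of f m x] by (cases "\<Sum>k. lagr_tail f m l x k") auto
    have "l k = c + 1" if "m < k" for k using that by (simp add: l_def)
    note tail = SUP_le_suminf_lagr_tail[OF l this c real R]
    have "v \<le> ?r 0 x + (\<Sum>k\<in>{1..m}. \<mu> k * ?r k x) + R"
      using bound[rule_format, OF edom tail(1)] tail(2) by simp
    also have "(\<Sum>k\<in>{1..m}. \<mu> k * ?r k x) = (\<Sum>k\<in>{1..m}. l k * ?r k x)"
      by (intro sum.cong) (auto simp: l_def)
    finally show ?thesis
      unfolding lagr_eq R using lagr_head_real[of m f x "\<lambda>k. ?r k x" l, OF real] by simp
  qed simp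
  then show ?thesis using l by blast
qed

lemma dual_solution_lower_bound:
  fixes f :: "nat \<Rightarrow> 'a::real_vector \<Rightarrow> ereal"
  assumes dual: "dual_solution f m l" and "\<And>k. proper_convex (f k)"
    and "y \<in> edom (f 0)" "(SUP k\<in>{1..}. f k y) < 0"
    and "\<forall>x\<in>edom (f 0). (\<forall>k\<ge>1. f k x \<le> 0) \<longrightarrow> ereal v \<le> f 0 x"
  shows "ereal v \<le> lagr f m l x"
proof -
  obtain l' where l': "linf_plus l'" "\<And>x. ereal v \<le> lagr f m l' x"
    using slater_strong_duality[OF assms(2-5), of m] by blast
  have "ereal v \<le> (INF x. lagr f m l' x)" by (intro INF_greatest l'(2))
  also have "\<dots> \<le> (INF x. lagr f m l x)" using dual l'(1) by (simp add: dual_solution_def)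
  also have "\<dots> \<le> lagr f m l x" by (rule INF_lower) simp
  finally show ?thesis .
qed

lemma complementary_slackness:
  assumes l: "linf_plus l" and optimum: "f 0 z = ereal v" and feasible: "\<And>k. 1 \<le> k \<Longrightarrow> f k z \<le> 0"
    and lower: "ereal v \<le> lagr f m l z" and k: "1 \<le> k"
  shows "k \<le> m \<Longrightarrow> emul (l k) (f k z) = 0" and "m < k \<Longrightarrow> emul (l k) (epos (f k z)) = 0"
proof -
  have tail: "emul (l k) (epos (f k z)) = 0" if "m < k" for k
    using feasible[of k] that by (simp add: epos_def max_absorb2 emul_def)
  then show "m < k \<Longrightarrow> emul (l k) (epos (f k z)) = 0" .
  have nonpos: "emul (l k) (f k z) \<le> 0" if "1 \<le> k" for k
    using feasible[OF that] l by (intro emul_nonpos) (auto simp: linf_plus_def)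
  have "lagr_tail f m l z = (\<lambda>_. 0)" using tail by (auto simp: lagr_tail_def)
  then have "ereal v \<le> ereal v + (\<Sum>k\<in>{1..m}. emul (l k) (f k z))"
    using lower by (simp add: lagr_eq lagr_head_def optimum)
  then have sum_nonneg: "0 \<le> (\<Sum>k\<in>{1..m}. emul (l k) (f k z))"
    by (cases "\<Sum>k\<in>{1..m}. emul (l k) (f k z)") auto
  show "emul (l k) (f k z) = 0" if "k \<le> m"
  proof (rule antisym[OF nonpos[OF k]])
    note sum_nonneg
    also have "(\<Sum>k\<in>{1..m}. emul (l k) (f k z))
        = emul (l k) (f k z) + (\<Sum>j\<in>{1..m} - {k}. emul (l j) (f j z))"
      using k that by (intro sum.remove) auto
    also have "\<dots> \<le> emul (l k) (f k z) + 0"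
      by (intro add_left_mono sum_nonpos nonpos) auto
    finally show "0 \<le> emul (l k) (f k z)" by simp
  qed
qed

section \<open>Fuzzy multiplier rule\<close>

lemma coll_0: "coll f m l 0 = f 0"
  and coll_head: "k \<in> {1..m} \<Longrightarrow> coll f m l k = (\<lambda>x. emul (l k) (f k x))"
  and coll_tail: "m < k \<Longrightarrow> coll f m l k = (\<lambda>x. emul (l k) (epos (f k x)))"
  by (auto simp: coll_def)

lemma sum_coll:
  assumes "m \<le> n"
  shows "(\<Sum>k\<le>n. coll f m l k (x k)) = f 0 (x 0) + (\<Sum>k\<in>{1..m}. emul (l k) (f k (x k)))
    + (\<Sum>k\<in>{m+1..n}. emul (l k) (epos (f k (x k))))"
proof -
  have "{..n} = insert 0 ({1..m} \<union> {m+1..n})" using assms by auto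
  then have "(\<Sum>k\<le>n. coll f m l k (x k)) = coll f m l 0 (x 0) +
      (\<Sum>k\<in>{1..m} \<union> {m+1..n}. coll f m l k (x k))" by simp
  also have "(\<Sum>k\<in>{1..m} \<union> {m+1..n}. coll f m l k (x k)) =
      (\<Sum>k\<in>{1..m}. coll f m l k (x k)) + (\<Sum>k\<in>{m+1..n}. coll f m l k (x k))"
    by (intro sum.union_disjoint) auto
  also have "(\<Sum>k\<in>{1..m}. coll f m l k (x k)) = (\<Sum>k\<in>{1..m}. emul (l k) (f k (x k)))"
    by (intro sum.cong) (simp_all add: coll_head coll_tail)
  also have "(\<Sum>k\<in>{m+1..n}. coll f m l k (x k)) = (\<Sum>k\<in>{m+1..n}. emul (l k) (epos (f k (x k))))"
    by (intro sum.cong) (simp_all add: coll_head coll_tail)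
  finally show ?thesis by (simp add: coll_0 add.assoc)
qed

lemma lagr_partial_sum:
  assumes "m \<le> n"
  shows "lagr_head f m l x + (\<Sum>k\<le>n. lagr_tail f m l x k) = (\<Sum>k\<le>n. coll f m l k x)"
proof -
  have "(\<Sum>k\<le>n. lagr_tail f m l x k) = (\<Sum>k\<in>{m+1..n}. lagr_tail f m l x k)"
    by (intro sum.mono_neutral_right) (auto simp: lagr_tail_def)
  also have "\<dots> = (\<Sum>k\<in>{m+1..n}. emul (l k) (epos (f k x)))"
    by (intro sum.cong) (auto simp: lagr_tail_def)
  finally show ?thesis by (simp add: sum_coll[OF assms, of f l "\<lambda>_. x"] lagr_head_def)
qed

lemma lagr_le_upper_sum:
  assumes l: "linf_plus l" and not_MInfty: "\<And>k. f k x \<noteq> -\<infinity>"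
  shows "lagr f m l x \<le> upper_sum (coll f m l) x"
  unfolding upper_sum_def limsup_fin_def
proof (rule INF_greatest)
  fix S0 :: "nat set" assume "S0 \<in> {S. finite S}"
  then obtain n0 where n0: "S0 \<subseteq> {..n0}" using finite_nat_iff_bounded_le by auto
  let ?B = "SUP S\<in>{S. finite S \<and> S0 \<subseteq> S}. \<Sum>t\<in>S. coll f m l t x"
  have "(\<Sum>k<N. lagr_tail f m l x k) + lagr_head f m l x \<le> ?B" for N
  proof -
    define n where "n = max N (max n0 m)"
    have "(\<Sum>k<N. lagr_tail f m l x k) \<le> (\<Sum>k\<le>n. lagr_tail f m l x k)"
      using lagr_tail_nonneg[OF l] by (intro sum_mono2) (auto simp: n_def)
    then have "(\<Sum>k<N. lagr_tail f m l x k) + lagr_head f m l x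
        \<le> lagr_head f m l x + (\<Sum>k\<le>n. lagr_tail f m l x k)"
      by (subst add.commute) (rule add_left_mono)
    also have "\<dots> = (\<Sum>k\<le>n. coll f m l k x)" by (rule lagr_partial_sum) (simp add: n_def)
    also have "\<dots> \<le> ?B" by (rule SUP_upper2[of "{..n}"]) (use n0 in \<open>auto simp: n_def\<close>)
    finally show ?thesis .
  qed
  then have "(\<Sum>k. lagr_tail f m l x k) + lagr_head f m l x \<le> ?B"
    using lagr_tail_nonneg[OF l] lagr_head_not_MInfty[of f x, OF not_MInfty]
    by (intro suminf_bound_add) auto
  then show "lagr f m l x \<le> ?B" by (simp add: lagr_eq add.commute)
qed

lemma proper_convex_coll:
  assumes f: "\<And>k. proper_convex (f k)" and l: "linf_plus l"
  shows "proper_convex (coll f m l k)"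
proof -
  have "0 \<le> l k" using l by (simp add: linf_plus_def)
  then have scaled: "proper_convex (\<lambda>x. emul (l k) (f k x))"
    "proper_convex (\<lambda>x. emul (l k) (epos (f k x)))"
    by (rule proper_convex_emul[OF f], rule proper_convex_emul[OF proper_convex_epos[OF f]])
  consider "k = 0" | "k \<in> {1..m}" | "m < k" by force
  then show ?thesis using scaled f[of 0] by cases (simp_all add: coll_0 coll_head coll_tail)
qed

lemma fsubdiff_coll_subset:
  fixes f :: "nat \<Rightarrow> 'a::real_normed_vector \<Rightarrow> ereal"
  assumes f: "proper_convex (f k)" and l: "linf_plus l" and x: "x \<in> edom (coll f m l k)"
  shows "k \<in> {1..m} \<Longrightarrow> fsubdiff (coll f m l k) x \<subseteq> scaled_subdiff (l k) (f k) x"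
    and "m < k \<Longrightarrow> fsubdiff (coll f m l k) x \<subseteq> scaled_subdiff (l k) (\<lambda>z. epos (f k z)) x"
proof -
  have c: "0 \<le> l k" using l by (simp add: linf_plus_def)
  show "fsubdiff (coll f m l k) x \<subseteq> scaled_subdiff (l k) (f k) x" if "k \<in> {1..m}"
    using fsubdiff_emul_subset[OF f c] x by (simp add: coll_head[OF that] edom_emul[OF c])
  show "fsubdiff (coll f m l k) x \<subseteq> scaled_subdiff (l k) (\<lambda>z. epos (f k z)) x" if "m < k"
    using fsubdiff_emul_subset[OF proper_convex_epos[OF f] c] x
    by (simp add: coll_tail[OF that] edom_emul[OF c])
qed

lemma uniformly_lsc_lower_bound:
  fixes g :: "nat \<Rightarrow> 'a::real_normed_vector \<Rightarrow> ereal"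
  assumes ulsc: "uniformly_lsc U g" and lower: "\<And>x. ereal v \<le> upper_sum g x" and \<eta>: "0 < \<eta>"
  shows "\<exists>n>M. \<exists>\<delta>>0. \<forall>x. (\<forall>k\<le>n. x k \<in> U) \<longrightarrow> (\<forall>i\<le>n. \<forall>j\<le>n. dist (x i) (x j) < \<delta>) \<longrightarrow>
    ereal v \<le> (\<Sum>k\<le>n. g k (x k)) + ereal \<eta>"
proof -
  define I where "I S \<delta> = (INF xs\<in>{xs. (\<forall>t\<in>S. xs t \<in> U) \<and> diameter (xs ` S) < \<delta>}. \<Sum>t\<in>S. g t (xs t))"
    for S \<delta>
  have "ereal v \<le> (INF x\<in>U. upper_sum g x)" by (intro INF_greatest lower)
  also have "\<dots> \<le> Lambda_U U g" using ulsc by (simp add: uniformly_lsc_def)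
  finally have "ereal (v - \<eta>) < Lambda_U U g" using \<eta> by (auto elim: less_le_trans[rotated])
  then obtain S0 where S0: "finite S0"
    "ereal (v - \<eta>) < (INF S\<in>{S. finite S \<and> S0 \<subseteq> S}. SUP \<delta>\<in>{0<..}. I S \<delta>)"
    by (auto simp: Lambda_U_def liminf_fin_def less_SUP_iff simp flip: I_def)
  obtain n0 where n0: "S0 \<subseteq> {..n0}" using S0(1) finite_nat_iff_bounded_le by auto
  define n where "n = max n0 (Suc M)"
  have "(INF S\<in>{S. finite S \<and> S0 \<subseteq> S}. SUP \<delta>\<in>{0<..}. I S \<delta>) \<le> (SUP \<delta>\<in>{0<..}. I {..n} \<delta>)"
    by (rule INF_lower) (use n0 in \<open>auto simp: n_def\<close>)
  then have "ereal (v - \<eta>) < (SUP \<delta>\<in>{0<..}. I {..n} \<delta>)" using S0(2) by (rule less_le_trans[rotated])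
  then obtain \<delta> where \<delta>: "0 < \<delta>" "ereal (v - \<eta>) < I {..n} \<delta>" by (auto simp: less_SUP_iff)
  have "ereal v \<le> (\<Sum>k\<le>n. g k (x k)) + ereal \<eta>"
    if x: "\<forall>k\<le>n. x k \<in> U" "\<forall>i\<le>n. \<forall>j\<le>n. dist (x i) (x j) < \<delta> / 2" for x
  proof -
    have "diameter (x ` {..n}) \<le> \<delta> / 2"
      using x(2) by (intro diameter_le) (auto simp: dist_norm less_imp_le)
    then have "I {..n} \<delta> \<le> (\<Sum>k\<le>n. g k (x k))"
      unfolding I_def using x(1) \<delta>(1) by (intro INF_lower) auto
    then have "ereal (v - \<eta>) \<le> (\<Sum>k\<le>n. g k (x k))" using \<delta>(2) by simp
    then show ?thesis by (cases "\<Sum>k\<le>n. g k (x k)") auto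
  qed
  moreover have "M < n" by (simp add: n_def)
  ultimately show ?thesis using half_gt_zero[OF \<delta>(1)] by blast
qed

theorem uniformly_lsc_fuzzy_sum_rule:
  fixes g :: "nat \<Rightarrow> 'a::banach \<Rightarrow> ereal"
  assumes g: "\<And>k. proper_convex (g k)" and c: "\<And>k. c \<in> edom (g k)"
    and V: "open V" "c \<in> V" and lsc: "\<And>k x. x \<in> V \<Longrightarrow> lsc_at x (g k)"
    and U: "c \<in> interior U" "uniformly_lsc U g"
    and lower: "\<And>x. ereal v \<le> upper_sum g x" and optimum: "\<And>n. (\<Sum>k\<le>n. g k c) \<le> ereal v"
    and \<epsilon>: "0 < \<epsilon>"
  shows "\<exists>n>M. \<exists>x y. (\<forall>k\<le>n. x k \<in> ball c \<epsilon> \<and> x k \<in> edom (g k) \<and> y k \<in> fsubdiff (g k) (x k)) \<and>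
    (\<Sum>k\<le>n. g k (x k)) \<le> ereal v \<and> norm (\<Sum>k\<le>n. y k) < \<epsilon>"
proof -
  have "open (interior U \<inter> V \<inter> ball c \<epsilon>)" "c \<in> interior U \<inter> V \<inter> ball c \<epsilon>"
    using U V \<epsilon> by auto
  then obtain r where r: "0 < r" "cball c r \<subseteq> interior U \<inter> V \<inter> ball c \<epsilon>"
    using open_contains_cball by blast
  have tolerance: "0 < \<epsilon> * r / 4" using r(1) \<epsilon> by simp
  obtain n \<delta> where n: "M < n" and \<delta>: "0 < \<delta>"
    and near: "\<forall>x. (\<forall>k\<le>n. x k \<in> U) \<longrightarrow> (\<forall>i\<le>n. \<forall>j\<le>n. dist (x i) (x j) < \<delta>) \<longrightarrow>
      ereal v \<le> (\<Sum>k\<le>n. g k (x k)) + ereal (\<epsilon> * r / 4)"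
    using uniformly_lsc_lower_bound[OF U(2) lower tolerance, of M] by (elim exE conjE)
  have "\<exists>x y. (\<forall>k\<in>{..n}. x k \<in> ball c r \<and> x k \<in> edom (g k) \<and> y k \<in> fsubdiff (g k) (x k)) \<and>
    (\<Sum>k\<le>n. g k (x k)) \<le> (\<Sum>k\<le>n. g k c) \<and> norm (\<Sum>k\<le>n. y k) \<le> \<epsilon> / 2"
  proof (rule fuzzy_sum_rule[OF finite_atMost g c _ r(1) _ \<delta>])
    show "lsc_at x (g k)" if "x \<in> cball c r" for k x using lsc r(2) that by blast
    show "\<epsilon> * r / 4 < \<epsilon> / 2 * r" using r(1) \<epsilon> by simp
    fix x :: "nat \<Rightarrow> 'a"
    assume x: "\<forall>k\<in>{..n}. x k \<in> cball c r" "\<forall>i\<in>{..n}. \<forall>j\<in>{..n}. dist (x i) (x j) < \<delta>"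
    have "cball c r \<subseteq> U" using r(2) interior_subset[of U] by blast
    then have "\<forall>k\<le>n. x k \<in> U" using x(1) by blast
    then have "ereal v \<le> (\<Sum>k\<le>n. g k (x k)) + ereal (\<epsilon> * r / 4)"
      using x(2) by (intro near[rule_format]) auto
    then show "(\<Sum>k\<le>n. g k c) \<le> (\<Sum>k\<le>n. g k (x k)) + ereal (\<epsilon> * r / 4)"
      by (rule order_trans[OF optimum])
  qed (use \<epsilon> in simp)
  then obtain x y
    where xy: "\<forall>k\<in>{..n}. x k \<in> ball c r \<and> x k \<in> edom (g k) \<and> y k \<in> fsubdiff (g k) (x k)"
      and sum_le: "(\<Sum>k\<le>n. g k (x k)) \<le> (\<Sum>k\<le>n. g k c)" and norm_y: "norm (\<Sum>k\<le>n. y k) \<le> \<epsilon> / 2"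
    by (elim exE conjE)
  have "ball c r \<subseteq> ball c \<epsilon>" using r(2) ball_subset_cball[of c r] by blast
  then have "\<forall>k\<le>n. x k \<in> ball c \<epsilon> \<and> x k \<in> edom (g k) \<and> y k \<in> fsubdiff (g k) (x k)"
    using xy by blast
  moreover have "(\<Sum>k\<le>n. g k (x k)) \<le> ereal v" by (rule order_trans[OF sum_le optimum])
  moreover have "norm (\<Sum>k\<le>n. y k) < \<epsilon>" using norm_y \<epsilon> by simp
  ultimately show ?thesis using n by (intro exI conjI)
qed

lemma coll_fuzzy_multipliers:
  fixes f :: "nat \<Rightarrow> 'a::banach \<Rightarrow> ereal"
  assumes proper: "\<And>k. proper_convex (f k)" and l: "linf_plus l"
    and coll_c: "\<And>k. coll f m l k c = (if k = 0 then ereal v else 0)"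
    and lower: "\<And>x. ereal v \<le> lagr f m l x"
    and V: "open V" "c \<in> V" and lsc: "\<And>k x. x \<in> V \<Longrightarrow> lsc_at x (coll f m l k)"
    and U: "c \<in> interior U" "uniformly_lsc U (coll f m l)"
    and \<epsilon>: "0 < \<epsilon>" and M: "m < M"
  shows "\<exists>n>M. \<exists>x :: nat \<Rightarrow> 'a.
    (\<forall>k\<le>n. x k \<in> ball c \<epsilon>) \<and>
    f 0 (x 0) + (\<Sum>k\<in>{1..m}. emul (l k) (f k (x k)))
      + (\<Sum>k\<in>{m+1..n}. emul (l k) (epos (f k (x k)))) \<le> ereal v \<and>
    (\<exists>x0' \<in> fsubdiff (f 0) (x 0). \<exists>y :: nat \<Rightarrow> ('a \<Rightarrow>\<^sub>L real).
      (\<forall>k\<in>{1..m}. y k \<in> scaled_subdiff (l k) (f k) (x k)) \<and>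
      (\<forall>k\<in>{m+1..n}. y k \<in> scaled_subdiff (l k) (\<lambda>z. epos (f k z)) (x k)) \<and>
      norm (x0' + (\<Sum>k\<in>{1..n}. y k)) < \<epsilon>)"
proof -
  have "\<exists>n>M. \<exists>x y. (\<forall>k\<le>n. x k \<in> ball c \<epsilon> \<and> x k \<in> edom (coll f m l k) \<and>
      y k \<in> fsubdiff (coll f m l k) (x k)) \<and>
    (\<Sum>k\<le>n. coll f m l k (x k)) \<le> ereal v \<and> norm (\<Sum>k\<le>n. y k) < \<epsilon>"
  proof (rule uniformly_lsc_fuzzy_sum_rule[OF proper_convex_coll[OF proper l] _ V lsc U _ _ \<epsilon>])
    show "ereal v \<le> upper_sum (coll f m l) x" for x
      by (rule order_trans[OF lower], rule lagr_le_upper_sum[OF l], rule proper_convex_not_MInfty[OF proper])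
  qed (simp_all add: edom_def coll_c)
  then obtain n x y where n: "M < n"
    and xy: "\<forall>k\<le>n. x k \<in> ball c \<epsilon> \<and> x k \<in> edom (coll f m l k) \<and> y k \<in> fsubdiff (coll f m l k) (x k)"
    and sum_le: "(\<Sum>k\<le>n. coll f m l k (x k)) \<le> ereal v" and norm_y: "norm (\<Sum>k\<le>n. y k) < \<epsilon>"
    by (elim exE conjE)
  have "m \<le> n" using M n by simp
  have "y 0 \<in> fsubdiff (f 0) (x 0)" using xy by (metis coll_0 le0)
  moreover have "y k \<in> scaled_subdiff (l k) (f k) (x k)" if "k \<in> {1..m}" for k
    using fsubdiff_coll_subset(1)[where f = f and x = "x k", OF proper l _ that] xy that \<open>m \<le> n\<close>
    by auto
  moreover have "y k \<in> scaled_subdiff (l k) (\<lambda>z. epos (f k z)) (x k)" if "k \<in> {m+1..n}" for k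
    using fsubdiff_coll_subset(2)[where f = f and k = k and m = m and x = "x k", OF proper l] xy that
    by auto
  moreover have "norm (y 0 + (\<Sum>k\<in>{1..n}. y k)) < \<epsilon>"
    using norm_y by (simp add: atMost_atLeast0 sum.atLeast_Suc_atMost)
  moreover have "\<forall>k\<le>n. x k \<in> ball c \<epsilon>" using xy by blast
  moreover note sum_le[unfolded sum_coll[OF \<open>m \<le> n\<close>]]
  ultimately show ?thesis using n by blast
qed

theorem theorem4p3:
  fixes f :: "nat \<Rightarrow> 'a::banach \<Rightarrow> ereal" and xbar :: 'a
    and m :: nat and l :: "nat \<Rightarrow> real"
  defines "C \<equiv> edom (f 0) \<inter> {x. \<forall>k\<ge>1. f k x \<le> 0}"
  assumes proper: "\<And>k. proper_convex (f k)"
    and C_ne: "C \<noteq> {}"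
    and sol: "xbar \<in> C" "\<And>x. x \<in> C \<Longrightarrow> f 0 xbar \<le> f 0 x"
    and slater: "\<exists>x\<in>edom (f 0). (SUP k\<in>{1..}. f k x) < 0"
    and dual: "dual_solution f m l"
    and lsc: "\<exists>U. open U \<and> xbar \<in> U \<and> (\<forall>k. \<forall>x\<in>U. lsc_at x (coll f m l k))"
    and ulsc: "\<exists>U. xbar \<in> interior U \<and> uniformly_lsc U (coll f m l)"
  shows "(\<forall>k\<in>{1..m}. emul (l k) (f k xbar) = 0) \<and>
    (\<forall>\<epsilon>>0. \<forall>M>m. \<exists>n>M. \<exists>x :: nat \<Rightarrow> 'a.
       (\<forall>k\<le>n. x k \<in> ball xbar \<epsilon>) \<and>
       f 0 (x 0) + (\<Sum>k\<in>{1..m}. emul (l k) (f k (x k)))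
         + (\<Sum>k\<in>{m+1..n}. emul (l k) (epos (f k (x k)))) \<le> f 0 xbar \<and>
       (\<exists>x0' \<in> fsubdiff (f 0) (x 0). \<exists>y :: nat \<Rightarrow> ('a \<Rightarrow>\<^sub>L real).
          (\<forall>k\<in>{1..m}. y k \<in> scaled_subdiff (l k) (f k) (x k)) \<and>
          (\<forall>k\<in>{m+1..n}. y k \<in> scaled_subdiff (l k) (\<lambda>z. epos (f k z)) (x k)) \<and>
          norm (x0' + (\<Sum>k\<in>{1..n}. y k)) < \<epsilon>))"
proof -
  have l: "linf_plus l" using dual by (simp add: dual_solution_def)
  have feasible: "xbar \<in> edom (f 0)" "\<And>k. 1 \<le> k \<Longrightarrow> f k xbar \<le> 0" using sol(1) by (auto simp: C_def)
  obtain v where v: "f 0 xbar = ereal v" using proper_convex_real[OF proper feasible(1)] by metis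
  obtain y where y: "y \<in> edom (f 0)" "(SUP k\<in>{1..}. f k y) < 0" using slater by blast
  have lower: "ereal v \<le> lagr f m l x" for x
    using sol(2) by (intro dual_solution_lower_bound[OF dual proper y]) (auto simp: C_def v)
  note slack = complementary_slackness[OF l v feasible(2) lower]
  have coll: "coll f m l k xbar = (if k = 0 then ereal v else 0)" for k
    using slack[of k] by (simp add: coll_def v)
  obtain V where "open V" "xbar \<in> V" "\<And>k x. x \<in> V \<Longrightarrow> lsc_at x (coll f m l k)" using lsc by blast
  moreover obtain U where "xbar \<in> interior U" "uniformly_lsc U (coll f m l)" using ulsc by blast
  ultimately show ?thesis
    unfolding v using slack(1) coll_fuzzy_multipliers[OF proper l coll lower] by simp
qed

end
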